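(* Let $\mathbf A$ be a simply-typed total combinatory algebra with $\mathbf A(\mathtt N)=\mathbb N$ which is extensional, in the sense that each $\mathbf A(\sigma\to\tau)$ is a set of functions $\mathbf A(\sigma)\to\mathbf A(\tau)$ (with application being function application), and which is a model of $\mathrm T_0$. Then no simplified Kohlenbach bar recursor $\Phi:\mathbf A(2)\times\mathbf A(2)\times\mathbf A(0)\rightharpoonup\mathbb N$ for $\mathbf A$ is $\mathrm T+\mathit{min}$ computable.
   Context: **Types.** $\sigma,\tau::=\mathtt N\mid\sigma\to\tau$. Pure types: $0=\mathtt N$, $k+1=k\to\mathtt N$. A total combinatory algebra contains elements behaving as the combinators $k$ and $s$ at all types. **$\mathrm T+\mathit{min}$ terms.** Simply typed $\lambda$-terms over constants $\widehat n:\mathtt N$ ($n\in\mathbb N$), $\mathit{suc},\mathit{pre}:\mathtt N\to\mathtt N$, $\mathit{ifzero}:\mathtt N\to\mathtt N\to\mathtt N\to\mathtt N$, $\mathit{rec}_\sigma:\sigma\to(\sigma\to\mathtt N\to\sigma)\to\mathtt N\to\sigma$ for every $\sigma$, and $\mathit{min}:(\mathtt N\to\mathtt N)\to\mathtt N\to\mathtt N$. $\mathrm T_0$ is the sublanguage without $\mathit{min}$ and with $\mathit{rec}_\sigma$ only for $\sigma$ of level $0$ (i.e. $\sigma=\mathtt N$). $\mathbf A$ is a model of $\mathrm T_0$ if it contains elements $\mathit{suc},\mathit{pre}$, $\mathit{ifzero}$ and $\mathit{rec}_{\mathtt N}$ satisfying the usual equations: $\mathit{suc}(n)=n+1$; $\mathit{pre}(0)=0$,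 $\mathit{pre}(n+1)=n$; $\mathit{ifzero}\,0\,x\,y=x$, $\mathit{ifzero}\,(n+1)\,x\,y=y$; $\mathit{rec}_{\mathtt N}\,x\,f\,0=x$, $\mathit{rec}_{\mathtt N}\,x\,f\,(n+1)=f(\mathit{rec}_{\mathtt N}\,x\,f\,n)\,n$. **Partial interpretation.** Every $\mathrm T+\mathit{min}$ term $M$ is $\beta\eta$-equivalent to one in long $\beta\eta$-normal form, denoted $\mathrm{nf}(M)$: a $\beta$-normal term in which every occurrence of a variable or constant is fully applied (heads a subterm of type $\mathtt N$). A valuation $\nu$ for $M$ assigns to each free variable $x^\sigma$ of $M$ an element $\nu(x)\in\mathbf A(\sigma)$. The relation $[\![M]\!]_\nu=a$, for $M:\sigma$ in long $\beta\eta$-normal form, $\nu$ a valuation for $M$ and $a\in\mathbf A(\sigma)$, is defined inductively by: 1. $[\![\widehat n]\!]_\nu=n$. 2. If $[\![M]\!]_\nu=n$ then $[\![\mathit{suc}\,M]\!]_\nu=n+1$ and $[\![\mathit{pre}\,M]\!]_\nu=n\dot-1$ (truncated subtraction). 3. If $[\![M]\!]_\nu=0$ and $[\![N]\!]_\nu=n$ then $[\![\mathit{ifzero}\,M\,N\,P]\!]_\nu=n$. 4. If $[\![M]\!]_\nu=m+1$ and $[\![P]\!]_\nu=n$ then $[\![\mathit{ifzero}\,M\,N\,P]\!]_\nu=n$. 5. If $[\![N]\!]_\nu=0$ and $[\![\mathrm{nf}(X\vec Y)]\!]_\nu=m$ then $[\![\mathit{rec}_\sigma\,X\,F\,N\,\vec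 Y]\!]_\nu=m$. 6. If $[\![N]\!]_\nu=n+1$ and $[\![\mathrm{nf}(F(\mathit{rec}_\sigma\,X\,F\,\widehat n)\,\widehat n\,\vec Y)]\!]_\nu=m$ then $[\![\mathit{rec}_\sigma\,X\,F\,N\,\vec Y]\!]_\nu=m$. 7. If $[\![N]\!]_\nu=n$ and $[\![\mathrm{nf}(F\,\widehat n)]\!]_\nu=0$ then $[\![\mathit{min}\,F\,N]\!]_\nu=n$. 8. If $[\![N]\!]_\nu=n$, $[\![\mathrm{nf}(F\,\widehat n)]\!]_\nu=i+1$ and $[\![\mathit{min}\,F\,\widehat{n+1}]\!]_\nu=m$ then $[\![\mathit{min}\,F\,N]\!]_\nu=m$. 9. If $f\in\mathbf A(\sigma\to\tau)$ and $[\![M]\!]_{\nu[y\mapsto a]}=f(a)$ for all $a\in\mathbf A(\sigma)$, where $y^\sigma\notin\mathrm{dom}\,\nu$, then $[\![\lambda y.M]\!]_\nu=f$. 10. If $\nu(x)=f$ and $[\![P_i]\!]_\nu=a_i$ for each $i<r$ then $[\![x P_0\ldots P_{r-1}]\!]_\nu=f(a_0,\ldots,a_{r-1})$ (curried application). **Computability.** A partial function $\Phi:\mathbf A(\sigma_0)\times\cdots\times\mathbf A(\sigma_{r-1})\rightharpoonup\mathbb N$ is *$\mathrm T+\mathit{min}$ computable* if there is a $\mathrm T+\mathit{min}$ term $M:\mathtt N$ (in long $\beta\eta$-normal form) with free variables among $x_0^{\sigma_0},\ldots,x_{r-1}^{\sigma_{r-1}}$ such that for all $a_i\in\mathbf A(\sigma_i)$,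 $[\![M]\!]_{x_0\mapsto a_0,\ldots,x_{r-1}\mapsto a_{r-1}}\simeq\Phi(a_0,\ldots,a_{r-1})$, where $\simeq$ is Kleene equality (both undefined, or both defined and equal). **Bar recursors.** $\langle\cdots\rangle:\mathbb N^*\to\mathbb N$ is a fixed standard (injective) primitive recursive coding of finite sequences. For $\vec x\in\mathbb N^*$ and $j\in\mathbb N$, $[\vec x\,j^\omega]:\mathbb N\to\mathbb N$ maps $i$ to $x_i$ if $i<|\vec x|$ and to $j$ otherwise; since $\mathbf A$ is a model of $\mathrm T_0$, these functions lie in $\mathbf A(1)$. For $F\in\mathbf A(2)$, the Kohlenbach tree $\mathcal T^K(F)$ consists of all $\vec x\in\mathbb N^*$ such that no proper prefix $\vec x'$ of $\vec x$ satisfies $F([\vec x'\,0^\omega])=F([\vec x'\,1^\omega])$. $\mathcal T^K(F)^l$ is its set of leaves (nodes with no child in the tree), $\mathcal T^K(F)^n$ its set of internal nodes; the tree is well-founded if it has no infinite path. A partial function $\Phi:\mathbf A(2)\times\mathbf A(2)\times\mathbf A(0)\rightharpoonup\mathbb N$ is a *simplified Kohlenbach bar recursor* for $\mathbf A$ if for all $F,G\in\mathbf A(2)$ with $\mathcal T^K(F)$ well-founded and all $\vec x\in\mathcal T^K(F)$: $\Phi(F,G,\langle\vec x\rangle)=2\langle\vec x\rangle+1$ if $\vec x\in\mathcal T^K(F)^l$; and $\Phi(F,G,\langle\vec x\rangle)=G(\Lambda z.\,\Phi(F,G,\langle\vec x,z\rangle))$ if $\vec x\in\mathcal T^K(F)^n$,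 where it is part of the condition that the function $\Lambda z.\,\Phi(F,G,\langle\vec x,z\rangle)$ ($z\mapsto\Phi(F,G,\langle\vec x,z\rangle)$) is present in $\mathbf A(1)$. *)

theory Defs
  imports Main "HOL-Library.Sublist" "HOL-Library.Nat_Bijection"
begin

datatype ty = Nty | Arrow ty ty  (infixr "\<^bold>\<rightarrow>" 60)

fun pure_ty :: "nat \<Rightarrow> ty" where
  "pure_ty 0 = Nty"
| "pure_ty (Suc k) = pure_ty k \<^bold>\<rightarrow> Nty"


section \<open>Extensional total combinatory algebras\<close>

text \<open>
  HOL has no type containing all hereditarily finite-type functionals over the naturals, so an
  extensional structure is given by its carriers (all inside one arbitrary type), the application
  operations and the identification of the carrier of type \<open>Nty\<close> with the natural numbers.
  Extensionality says that an element of \<open>car A (\<sigma> \<^bold>\<rightarrow> \<tau>)\<close> is determined by the function from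
  \<open>car A \<sigma>\<close> to \<open>car A \<tau>\<close> that it induces. Application carries its types because the carriers
  of different types are not required to be disjoint.
\<close>

record 'a type_structure =
  car :: "ty \<Rightarrow> 'a set"
  ap :: "ty \<Rightarrow> ty \<Rightarrow> 'a \<Rightarrow> 'a \<Rightarrow> 'a"
  num :: "nat \<Rightarrow> 'a"

locale extensional_tca =
  fixes A :: "'a type_structure"
  assumes num_bij: "bij_betw (num A) UNIV (car A Nty)"
    and ap_closed: "\<And>\<sigma> \<tau> f a. f \<in> car A (\<sigma> \<^bold>\<rightarrow> \<tau>) \<Longrightarrow> a \<in> car A \<sigma> \<Longrightarrow> ap A \<sigma> \<tau> f a \<in> car A \<tau>"
    and extensional: "\<And>\<sigma> \<tau> f g. f \<in> car A (\<sigma> \<^bold>\<rightarrow> \<tau>) \<Longrightarrow> g \<in> car A (\<sigma> \<^bold>\<rightarrow> \<tau>) \<Longrightarrow>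
          (\<And>a. a \<in> car A \<sigma> \<Longrightarrow> ap A \<sigma> \<tau> f a = ap A \<sigma> \<tau> g a) \<Longrightarrow> f = g"
    and ex_k: "\<And>\<sigma> \<tau>. \<exists>k \<in> car A (\<sigma> \<^bold>\<rightarrow> \<tau> \<^bold>\<rightarrow> \<sigma>). \<forall>x \<in> car A \<sigma>. \<forall>y \<in> car A \<tau>.
          ap A \<tau> \<sigma> (ap A \<sigma> (\<tau> \<^bold>\<rightarrow> \<sigma>) k x) y = x"
    and ex_s: "\<And>\<rho> \<sigma> \<tau>. \<exists>s \<in> car A ((\<rho> \<^bold>\<rightarrow> \<sigma> \<^bold>\<rightarrow> \<tau>) \<^bold>\<rightarrow> (\<rho> \<^bold>\<rightarrow> \<sigma>) \<^bold>\<rightarrow> \<rho> \<^bold>\<rightarrow> \<tau>).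
          \<forall>x \<in> car A (\<rho> \<^bold>\<rightarrow> \<sigma> \<^bold>\<rightarrow> \<tau>). \<forall>y \<in> car A (\<rho> \<^bold>\<rightarrow> \<sigma>). \<forall>z \<in> car A \<rho>.
            ap A \<rho> \<tau> (ap A (\<rho> \<^bold>\<rightarrow> \<sigma>) (\<rho> \<^bold>\<rightarrow> \<tau>)
                (ap A (\<rho> \<^bold>\<rightarrow> \<sigma> \<^bold>\<rightarrow> \<tau>) ((\<rho> \<^bold>\<rightarrow> \<sigma>) \<^bold>\<rightarrow> \<rho> \<^bold>\<rightarrow> \<tau>) s x) y) z
            = ap A \<sigma> \<tau> (ap A \<rho> (\<sigma> \<^bold>\<rightarrow> \<tau>) x z) (ap A \<rho> \<sigma> y z)"

text \<open>Curried application of an element of the given type to a list of arguments; meaningful only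
  if the list is not longer than the number of arguments of the type.\<close>

fun ap_list :: "'a type_structure \<Rightarrow> ty \<Rightarrow> 'a \<Rightarrow> 'a list \<Rightarrow> 'a" where
  "ap_list A \<sigma> f [] = f"
| "ap_list A (\<sigma> \<^bold>\<rightarrow> \<tau>) f (a # as) = ap_list A \<tau> (ap A \<sigma> \<tau> f a) as"
| "ap_list A Nty f (a # as) = undefined"

locale T0_model = extensional_tca +
  assumes ex_suc: "\<exists>suc \<in> car A (Nty \<^bold>\<rightarrow> Nty).
          \<forall>n. ap A Nty Nty suc (num A n) = num A (n + 1)"
    and ex_pre: "\<exists>pre \<in> car A (Nty \<^bold>\<rightarrow> Nty).
          ap A Nty Nty pre (num A 0) = num A 0 \<and>
          (\<forall>n. ap A Nty Nty pre (num A (n + 1)) = num A n)"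
    and ex_ifzero: "\<exists>ifzero \<in> car A (Nty \<^bold>\<rightarrow> Nty \<^bold>\<rightarrow> Nty \<^bold>\<rightarrow> Nty).
          \<forall>x \<in> car A Nty. \<forall>y \<in> car A Nty.
            ap_list A (Nty \<^bold>\<rightarrow> Nty \<^bold>\<rightarrow> Nty \<^bold>\<rightarrow> Nty) ifzero [num A 0, x, y] = x \<and>
            (\<forall>n. ap_list A (Nty \<^bold>\<rightarrow> Nty \<^bold>\<rightarrow> Nty \<^bold>\<rightarrow> Nty) ifzero [num A (n + 1), x, y] = y)"
    and ex_rec: "\<exists>rc \<in> car A (Nty \<^bold>\<rightarrow> (Nty \<^bold>\<rightarrow> Nty \<^bold>\<rightarrow> Nty) \<^bold>\<rightarrow> Nty \<^bold>\<rightarrow> Nty).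
          \<forall>x \<in> car A Nty. \<forall>f \<in> car A (Nty \<^bold>\<rightarrow> Nty \<^bold>\<rightarrow> Nty).
            ap_list A (Nty \<^bold>\<rightarrow> (Nty \<^bold>\<rightarrow> Nty \<^bold>\<rightarrow> Nty) \<^bold>\<rightarrow> Nty \<^bold>\<rightarrow> Nty) rc [x, f, num A 0] = x \<and>
            (\<forall>n. ap_list A (Nty \<^bold>\<rightarrow> (Nty \<^bold>\<rightarrow> Nty \<^bold>\<rightarrow> Nty) \<^bold>\<rightarrow> Nty \<^bold>\<rightarrow> Nty) rc [x, f, num A (n + 1)]
              = ap_list A (Nty \<^bold>\<rightarrow> Nty \<^bold>\<rightarrow> Nty) f
                  [ap_list A (Nty \<^bold>\<rightarrow> (Nty \<^bold>\<rightarrow> Nty \<^bold>\<rightarrow> Nty) \<^bold>\<rightarrow> Nty \<^bold>\<rightarrow> Nty) rc [x, f, num A n],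
                   num A n])"


section \<open>Terms of T + min\<close>

datatype cnst = Numeral nat | Succ | Pred | Ifzero | Rec ty | Min

fun cnst_ty :: "cnst \<Rightarrow> ty" where
  "cnst_ty (Numeral n) = Nty"
| "cnst_ty Succ = Nty \<^bold>\<rightarrow> Nty"
| "cnst_ty Pred = Nty \<^bold>\<rightarrow> Nty"
| "cnst_ty Ifzero = Nty \<^bold>\<rightarrow> Nty \<^bold>\<rightarrow> Nty \<^bold>\<rightarrow> Nty"
| "cnst_ty (Rec \<sigma>) = \<sigma> \<^bold>\<rightarrow> (\<sigma> \<^bold>\<rightarrow> Nty \<^bold>\<rightarrow> \<sigma>) \<^bold>\<rightarrow> Nty \<^bold>\<rightarrow> \<sigma>"
| "cnst_ty Min = (Nty \<^bold>\<rightarrow> Nty) \<^bold>\<rightarrow> Nty \<^bold>\<rightarrow> Nty"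

text \<open>Variables are de Bruijn indices, so that terms are identified up to renaming of bound
  variables.\<close>

datatype tm = Var nat | Cn cnst | Lam ty tm | App tm tm  (infixl "\<^bold>\<cdot>" 200)

abbreviation numeral_tm :: "nat \<Rightarrow> tm" where
  "numeral_tm n \<equiv> Cn (Numeral n)"

definition app_list :: "tm \<Rightarrow> tm list \<Rightarrow> tm" where
  "app_list M Ps = foldl App M Ps"

text \<open>A context \<open>\<Gamma>\<close> lists the types of the free variables \<open>Var 0\<close>, \<open>Var 1\<close>, \<dots>\<close>

inductive has_ty :: "ty list \<Rightarrow> tm \<Rightarrow> ty \<Rightarrow> bool" where
  ty_Var: "i < length \<Gamma> \<Longrightarrow> has_ty \<Gamma> (Var i) (\<Gamma> ! i)"
| ty_Cn: "has_ty \<Gamma> (Cn c) (cnst_ty c)"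
| ty_Lam: "has_ty (\<sigma> # \<Gamma>) M \<tau> \<Longrightarrow> has_ty \<Gamma> (Lam \<sigma> M) (\<sigma> \<^bold>\<rightarrow> \<tau>)"
| ty_App: "has_ty \<Gamma> M (\<sigma> \<^bold>\<rightarrow> \<tau>) \<Longrightarrow> has_ty \<Gamma> P \<sigma> \<Longrightarrow> has_ty \<Gamma> (M \<^bold>\<cdot> P) \<tau>"

fun lift :: "nat \<Rightarrow> tm \<Rightarrow> tm" where
  "lift k (Var i) = (if i < k then Var i else Var (Suc i))"
| "lift k (Cn c) = Cn c"
| "lift k (Lam \<sigma> M) = Lam \<sigma> (lift (Suc k) M)"
| "lift k (M \<^bold>\<cdot> P) = lift k M \<^bold>\<cdot> lift k P"

text \<open>\<open>subst k N M\<close> replaces the index \<open>k\<close> in \<open>M\<close> by \<open>N\<close> and decrements the larger indices.\<close>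

fun subst :: "nat \<Rightarrow> tm \<Rightarrow> tm \<Rightarrow> tm" where
  "subst k N (Var i) = (if i < k then Var i else if i = k then N else Var (i - 1))"
| "subst k N (Cn c) = Cn c"
| "subst k N (Lam \<sigma> M) = Lam \<sigma> (subst (Suc k) (lift 0 N) M)"
| "subst k N (M \<^bold>\<cdot> P) = subst k N M \<^bold>\<cdot> subst k N P"

text \<open>\<open>\<beta>\<eta>\<close>-equivalence of well-typed terms of the same type\<close>

inductive beta_eta :: "ty list \<Rightarrow> tm \<Rightarrow> tm \<Rightarrow> ty \<Rightarrow> bool" where
  be_beta: "has_ty (\<sigma> # \<Gamma>) M \<tau> \<Longrightarrow> has_ty \<Gamma> P \<sigma> \<Longrightarrow> beta_eta \<Gamma> (Lam \<sigma> M \<^bold>\<cdot> P) (subst 0 P M) \<tau>"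
| be_eta: "has_ty \<Gamma> M (\<sigma> \<^bold>\<rightarrow> \<tau>) \<Longrightarrow> beta_eta \<Gamma> (Lam \<sigma> (lift 0 M \<^bold>\<cdot> Var 0)) M (\<sigma> \<^bold>\<rightarrow> \<tau>)"
| be_refl: "has_ty \<Gamma> M \<tau> \<Longrightarrow> beta_eta \<Gamma> M M \<tau>"
| be_sym: "beta_eta \<Gamma> M M' \<tau> \<Longrightarrow> beta_eta \<Gamma> M' M \<tau>"
| be_trans: "beta_eta \<Gamma> M M' \<tau> \<Longrightarrow> beta_eta \<Gamma> M' M'' \<tau> \<Longrightarrow> beta_eta \<Gamma> M M'' \<tau>"
| be_App: "beta_eta \<Gamma> M M' (\<sigma> \<^bold>\<rightarrow> \<tau>) \<Longrightarrow> beta_eta \<Gamma> P P' \<sigma> \<Longrightarrow> beta_eta \<Gamma> (M \<^bold>\<cdot> P) (M' \<^bold>\<cdot> P') \<tau>"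
| be_Lam: "beta_eta (\<sigma> # \<Gamma>) M M' \<tau> \<Longrightarrow> beta_eta \<Gamma> (Lam \<sigma> M) (Lam \<sigma> M') (\<sigma> \<^bold>\<rightarrow> \<tau>)"

fun beta_normal :: "tm \<Rightarrow> bool" where
  "beta_normal (Var i) = True"
| "beta_normal (Cn c) = True"
| "beta_normal (Lam \<sigma> M) = beta_normal M"
| "beta_normal (M \<^bold>\<cdot> P) = (beta_normal M \<and> beta_normal P \<and> (\<forall>\<sigma> M'. M \<noteq> Lam \<sigma> M'))"

text \<open>Every occurrence of a variable or constant heads a subterm of type \<open>Nty\<close>. The flag \<open>b\<close> records
  that the traversed term stands in function position of an enclosing application, with the same
  head, that has type \<open>Nty\<close>.\<close>

fun fully_applied :: "bool \<Rightarrow> ty list \<Rightarrow> tm \<Rightarrow> bool" where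
  "fully_applied b \<Gamma> (Var i) = (b \<or> has_ty \<Gamma> (Var i) Nty)"
| "fully_applied b \<Gamma> (Cn c) = (b \<or> has_ty \<Gamma> (Cn c) Nty)"
| "fully_applied b \<Gamma> (Lam \<sigma> M) = fully_applied False (\<sigma> # \<Gamma>) M"
| "fully_applied b \<Gamma> (M \<^bold>\<cdot> P) =
     (fully_applied (b \<or> has_ty \<Gamma> (M \<^bold>\<cdot> P) Nty) \<Gamma> M \<and> fully_applied False \<Gamma> P)"

definition long_nf :: "ty list \<Rightarrow> tm \<Rightarrow> ty \<Rightarrow> bool" where
  "long_nf \<Gamma> M \<sigma> \<longleftrightarrow> has_ty \<Gamma> M \<sigma> \<and> beta_normal M \<and> fully_applied False \<Gamma> M"

text \<open>\<open>nf_of \<Gamma> M N\<close>: \<open>N\<close> is the long \<open>\<beta>\<eta>\<close>-normal form \<open>nf(M)\<close> of \<open>M\<close>. As every typable term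
  has exactly one, this relation is the graph of \<open>nf\<close>.\<close>

definition nf_of :: "ty list \<Rightarrow> tm \<Rightarrow> tm \<Rightarrow> bool" where
  "nf_of \<Gamma> M N \<longleftrightarrow> (\<exists>\<sigma>. long_nf \<Gamma> N \<sigma> \<and> beta_eta \<Gamma> M N \<sigma>)"


section \<open>The partial interpretation\<close>

text \<open>\<open>\<nu>\<close> assigns the value \<open>\<nu> ! i\<close> to the variable \<open>Var i\<close>.\<close>

definition valuation :: "'a type_structure \<Rightarrow> ty list \<Rightarrow> 'a list \<Rightarrow> bool" where
  "valuation A \<Gamma> \<nu> \<longleftrightarrow> list_all2 (\<lambda>a \<sigma>. a \<in> car A \<sigma>) \<nu> \<Gamma>"

text \<open>\<open>interp A \<Gamma> \<nu> M a\<close> is meant for \<open>M\<close> in long \<open>\<beta>\<eta>\<close>-normal form in context \<open>\<Gamma>\<close> and for a valuation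
  \<open>\<nu>\<close> of \<open>\<Gamma>\<close>. Both conditions are inherited by the premises of each rule, so it suffices to
  impose them on the conclusion of a derivation.\<close>

inductive interp :: "'a type_structure \<Rightarrow> ty list \<Rightarrow> 'a list \<Rightarrow> tm \<Rightarrow> 'a \<Rightarrow> bool"
  for A :: "'a type_structure" where
  i_numeral: "interp A \<Gamma> \<nu> (numeral_tm n) (num A n)"
| i_suc: "interp A \<Gamma> \<nu> M (num A n) \<Longrightarrow> interp A \<Gamma> \<nu> (Cn Succ \<^bold>\<cdot> M) (num A (n + 1))"
| i_pre: "interp A \<Gamma> \<nu> M (num A n) \<Longrightarrow> interp A \<Gamma> \<nu> (Cn Pred \<^bold>\<cdot> M) (num A (n - 1))"
| i_ifzero_0: "interp A \<Gamma> \<nu> M (num A 0) \<Longrightarrow> interp A \<Gamma> \<nu> N (num A n) \<Longrightarrow>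
    interp A \<Gamma> \<nu> (Cn Ifzero \<^bold>\<cdot> M \<^bold>\<cdot> N \<^bold>\<cdot> P) (num A n)"
| i_ifzero_Suc: "interp A \<Gamma> \<nu> M (num A (m + 1)) \<Longrightarrow> interp A \<Gamma> \<nu> P (num A n) \<Longrightarrow>
    interp A \<Gamma> \<nu> (Cn Ifzero \<^bold>\<cdot> M \<^bold>\<cdot> N \<^bold>\<cdot> P) (num A n)"
| i_rec_0: "interp A \<Gamma> \<nu> N (num A 0) \<Longrightarrow>
    nf_of \<Gamma> (app_list X Ys) M \<Longrightarrow> interp A \<Gamma> \<nu> M (num A m) \<Longrightarrow>
    interp A \<Gamma> \<nu> (app_list (Cn (Rec \<sigma>) \<^bold>\<cdot> X \<^bold>\<cdot> F \<^bold>\<cdot> N) Ys) (num A m)"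
| i_rec_Suc: "interp A \<Gamma> \<nu> N (num A (n + 1)) \<Longrightarrow>
    nf_of \<Gamma> (app_list (F \<^bold>\<cdot> (Cn (Rec \<sigma>) \<^bold>\<cdot> X \<^bold>\<cdot> F \<^bold>\<cdot> numeral_tm n) \<^bold>\<cdot> numeral_tm n) Ys) M \<Longrightarrow>
    interp A \<Gamma> \<nu> M (num A m) \<Longrightarrow>
    interp A \<Gamma> \<nu> (app_list (Cn (Rec \<sigma>) \<^bold>\<cdot> X \<^bold>\<cdot> F \<^bold>\<cdot> N) Ys) (num A m)"
| i_min_0: "interp A \<Gamma> \<nu> N (num A n) \<Longrightarrow>
    nf_of \<Gamma> (F \<^bold>\<cdot> numeral_tm n) M \<Longrightarrow> interp A \<Gamma> \<nu> M (num A 0) \<Longrightarrow>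
    interp A \<Gamma> \<nu> (Cn Min \<^bold>\<cdot> F \<^bold>\<cdot> N) (num A n)"
| i_min_Suc: "interp A \<Gamma> \<nu> N (num A n) \<Longrightarrow>
    nf_of \<Gamma> (F \<^bold>\<cdot> numeral_tm n) M \<Longrightarrow> interp A \<Gamma> \<nu> M (num A (i + 1)) \<Longrightarrow>
    interp A \<Gamma> \<nu> (Cn Min \<^bold>\<cdot> F \<^bold>\<cdot> numeral_tm (n + 1)) (num A m) \<Longrightarrow>
    interp A \<Gamma> \<nu> (Cn Min \<^bold>\<cdot> F \<^bold>\<cdot> N) (num A m)"
| i_lam: "has_ty (\<sigma> # \<Gamma>) M \<tau> \<Longrightarrow> f \<in> car A (\<sigma> \<^bold>\<rightarrow> \<tau>) \<Longrightarrow>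
    (\<And>a. a \<in> car A \<sigma> \<Longrightarrow> interp A (\<sigma> # \<Gamma>) (a # \<nu>) M (ap A \<sigma> \<tau> f a)) \<Longrightarrow>
    interp A \<Gamma> \<nu> (Lam \<sigma> M) f"
| i_var: "x < length \<Gamma> \<Longrightarrow> \<nu> ! x = f \<Longrightarrow> length as = length Ps \<Longrightarrow>
    (\<And>i. i < length Ps \<Longrightarrow> interp A \<Gamma> \<nu> (Ps ! i) (as ! i)) \<Longrightarrow>
    interp A \<Gamma> \<nu> (app_list (Var x) Ps) (ap_list A (\<Gamma> ! x) f as)"

text \<open>A partial function on \<open>car A \<sigma>\<^sub>0 \<times> \<dots> \<times> car A \<sigma>\<^sub>r\<^sub>-\<^sub>1\<close> is represented on argument lists; its values on
  other lists are irrelevant.\<close>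

definition T_min_computable ::
    "'a type_structure \<Rightarrow> ty list \<Rightarrow> ('a list \<Rightarrow> nat option) \<Rightarrow> bool" where
  "T_min_computable A \<sigma>s \<Phi> \<longleftrightarrow> (\<exists>M. long_nf \<sigma>s M Nty \<and>
     (\<forall>as. valuation A \<sigma>s as \<longrightarrow> (\<forall>m. interp A \<sigma>s as M (num A m) \<longleftrightarrow> \<Phi> as = Some m)))"


section \<open>Kohlenbach trees and bar recursors\<close>

definition represents :: "'a type_structure \<Rightarrow> 'a \<Rightarrow> (nat \<Rightarrow> nat) \<Rightarrow> bool" where
  "represents A h g \<longleftrightarrow> h \<in> car A (pure_ty 1) \<and> (\<forall>i. ap A Nty Nty h (num A i) = num A (g i))"

definition padded :: "nat list \<Rightarrow> nat \<Rightarrow> nat \<Rightarrow> nat" where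
  "padded xs j i = (if i < length xs then xs ! i else j)"

definition padded_elem :: "'a type_structure \<Rightarrow> nat list \<Rightarrow> nat \<Rightarrow> 'a" where
  "padded_elem A xs j = (THE h. represents A h (padded xs j))"

definition kohlenbach_tree :: "'a type_structure \<Rightarrow> 'a \<Rightarrow> nat list set" where
  "kohlenbach_tree A F = {xs. \<not> (\<exists>xs'. strict_prefix xs' xs \<and>
     ap A (pure_ty 1) Nty F (padded_elem A xs' 0) = ap A (pure_ty 1) Nty F (padded_elem A xs' 1))}"

definition leaves :: "nat list set \<Rightarrow> nat list set" where
  "leaves T = {xs \<in> T. \<forall>z. xs @ [z] \<notin> T}"

definition internal_nodes :: "nat list set \<Rightarrow> nat list set" where
  "internal_nodes T = {xs \<in> T. \<exists>z. xs @ [z] \<in> T}"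

definition wf_tree :: "nat list set \<Rightarrow> bool" where
  "wf_tree T \<longleftrightarrow> \<not> (\<exists>f :: nat \<Rightarrow> nat. \<forall>n. map f [0..<n] \<in> T)"

text \<open>The coding of finite sequences is \<^const>\<open>list_encode\<close>, a primitive recursive bijection.\<close>

definition simplified_kohlenbach_bar_recursor ::
    "'a type_structure \<Rightarrow> ('a \<Rightarrow> 'a \<Rightarrow> 'a \<Rightarrow> nat option) \<Rightarrow> bool" where
  "simplified_kohlenbach_bar_recursor A \<Phi> \<longleftrightarrow>
    (\<forall>F \<in> car A (pure_ty 2). \<forall>G \<in> car A (pure_ty 2).
      wf_tree (kohlenbach_tree A F) \<longrightarrow>
      (\<forall>xs \<in> kohlenbach_tree A F.
        (xs \<in> leaves (kohlenbach_tree A F) \<longrightarrow>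
          \<Phi> F G (num A (list_encode xs)) = Some (2 * list_encode xs + 1)) \<and>
        (xs \<in> internal_nodes (kohlenbach_tree A F) \<longrightarrow>
          (\<exists>g h m. (\<forall>z. \<Phi> F G (num A (list_encode (xs @ [z]))) = Some (g z)) \<and>
             represents A h g \<and>
             ap A (pure_ty 1) Nty G h = num A m \<and>
             \<Phi> F G (num A (list_encode xs)) = Some m))))"

text \<open>The description in \<^const>\<open>padded_elem\<close> is proper in every model of T0.\<close>

lemma (in extensional_tca) represents_unique:
  assumes "represents A h g" "represents A h' g"
  shows "h = h'"
proof (rule extensional)
  show "h \<in> car A (Nty \<^bold>\<rightarrow> Nty)" "h' \<in> car A (Nty \<^bold>\<rightarrow> Nty)"
    using assms by (auto simp: represents_def)
  fix a assume "a \<in> car A Nty"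
  then obtain n where "a = num A n"
    using num_bij by (auto simp: bij_betw_def)
  then show "ap A Nty Nty h a = ap A Nty Nty h' a"
    using assms by (simp add: represents_def)
qed

lemma (in T0_model) padded_ex: "\<exists>h. represents A h (padded xs j)"
proof (induction xs)
  case Nil
  have n: "num A i \<in> car A Nty" for i
    using num_bij by (auto simp: bij_betw_def)
  obtain k where "k \<in> car A (Nty \<^bold>\<rightarrow> Nty \<^bold>\<rightarrow> Nty)"
    "\<forall>x \<in> car A Nty. \<forall>y \<in> car A Nty. ap A Nty Nty (ap A Nty (Nty \<^bold>\<rightarrow> Nty) k x) y = x"
    using ex_k[of Nty Nty] by auto
  then have "represents A (ap A Nty (Nty \<^bold>\<rightarrow> Nty) k (num A j)) (padded [] j)"
    using n by (auto simp: represents_def padded_def intro: ap_closed)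
  then show ?case ..
next
  case (Cons x xs)
  let ?NN = "Nty \<^bold>\<rightarrow> Nty" and ?NNN = "Nty \<^bold>\<rightarrow> Nty \<^bold>\<rightarrow> Nty"
  have n: "num A i \<in> car A Nty" for i
    using num_bij by (auto simp: bij_betw_def)
  from Cons obtain h where h: "h \<in> car A ?NN"
    and h_eq: "\<And>i. ap A Nty Nty h (num A i) = num A (padded xs j i)"
    by (auto simp: represents_def)
  obtain k where k: "k \<in> car A ?NNN"
    and k_eq: "\<And>x y. x \<in> car A Nty \<Longrightarrow> y \<in> car A Nty \<Longrightarrow> ap A Nty Nty (ap A Nty ?NN k x) y = x"
    using ex_k[of Nty Nty] by auto
  obtain k' where k': "k' \<in> car A (?NN \<^bold>\<rightarrow> Nty \<^bold>\<rightarrow> ?NN)"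
    and k'_eq: "\<And>x y. x \<in> car A ?NN \<Longrightarrow> y \<in> car A Nty \<Longrightarrow>
      ap A Nty ?NN (ap A ?NN (Nty \<^bold>\<rightarrow> ?NN) k' x) y = x"
    using ex_k[of ?NN Nty] by auto
  obtain s where s: "s \<in> car A (?NNN \<^bold>\<rightarrow> ?NN \<^bold>\<rightarrow> ?NN)"
    and s_eq: "\<And>f g z. f \<in> car A ?NNN \<Longrightarrow> g \<in> car A ?NN \<Longrightarrow> z \<in> car A Nty \<Longrightarrow>
       ap A Nty Nty (ap A ?NN ?NN (ap A ?NNN (?NN \<^bold>\<rightarrow> ?NN) s f) g) z
       = ap A Nty Nty (ap A Nty ?NN f z) (ap A Nty Nty g z)"
    using ex_s[of Nty Nty Nty] by auto
  obtain s' where s': "s' \<in> car A ((Nty \<^bold>\<rightarrow> ?NNN) \<^bold>\<rightarrow> ?NN \<^bold>\<rightarrow> ?NNN)"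
    and s'_eq: "\<And>f g z. f \<in> car A (Nty \<^bold>\<rightarrow> ?NNN) \<Longrightarrow> g \<in> car A ?NN \<Longrightarrow> z \<in> car A Nty \<Longrightarrow>
       ap A Nty ?NN (ap A ?NN ?NNN (ap A (Nty \<^bold>\<rightarrow> ?NNN) (?NN \<^bold>\<rightarrow> ?NNN) s' f) g) z
       = ap A Nty ?NN (ap A Nty ?NNN f z) (ap A Nty Nty g z)"
    using ex_s[of Nty Nty ?NN] by auto
  obtain p where p: "p \<in> car A ?NN" and p0: "ap A Nty Nty p (num A 0) = num A 0"
    and p1: "\<And>n. ap A Nty Nty p (num A (Suc n)) = num A n"
    using ex_pre by auto
  obtain c where c: "c \<in> car A (Nty \<^bold>\<rightarrow> ?NNN)"
    and c0: "\<And>x y. x \<in> car A Nty \<Longrightarrow> y \<in> car A Nty \<Longrightarrow>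
      ap A Nty Nty (ap A Nty ?NN (ap A Nty ?NNN c (num A 0)) x) y = x"
    and c1: "\<And>n x y. x \<in> car A Nty \<Longrightarrow> y \<in> car A Nty \<Longrightarrow>
      ap A Nty Nty (ap A Nty ?NN (ap A Nty ?NNN c (num A (Suc n))) x) y = y"
    using ex_ifzero by auto
  define kx where "kx = ap A Nty ?NN k (num A x)"
  have kx: "kx \<in> car A ?NN" unfolding kx_def by (rule ap_closed[OF k n])
  define kh where "kh = ap A ?NN ?NNN k' h"
  have kh: "kh \<in> car A ?NNN" unfolding kh_def by (rule ap_closed[OF k' h])
  define u where "u = ap A ?NN ?NNN (ap A (Nty \<^bold>\<rightarrow> ?NNN) (?NN \<^bold>\<rightarrow> ?NNN) s' c) kx"
  have u: "u \<in> car A ?NNN" unfolding u_def by (rule ap_closed[OF ap_closed[OF s' c] kx])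
  define v where "v = ap A ?NN ?NN (ap A ?NNN (?NN \<^bold>\<rightarrow> ?NN) s kh) p"
  have v: "v \<in> car A ?NN" unfolding v_def by (rule ap_closed[OF ap_closed[OF s kh] p])
  define w where "w = ap A ?NN ?NN (ap A ?NNN (?NN \<^bold>\<rightarrow> ?NN) s u) v"
  have w: "w \<in> car A ?NN" unfolding w_def by (rule ap_closed[OF ap_closed[OF s u] v])
  have kx_eq: "ap A Nty Nty kx (num A i) = num A x" for i
    unfolding kx_def by (rule k_eq[OF n n])
  have kh_eq: "ap A Nty ?NN kh (num A i) = h" for i
    unfolding kh_def by (rule k'_eq[OF h n])
  have u_eq: "ap A Nty ?NN u (num A i) = ap A Nty ?NN (ap A Nty ?NNN c (num A i)) (num A x)" for i
    unfolding u_def s'_eq[OF c kx n] kx_eq ..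
  have v_eq: "ap A Nty Nty v (num A i) = ap A Nty Nty h (ap A Nty Nty p (num A i))" for i
    unfolding v_def s_eq[OF kh p n] kh_eq ..
  have "ap A Nty Nty w (num A i) = num A (padded (x # xs) j i)" for i
    unfolding w_def s_eq[OF u v n] u_eq v_eq
    by (cases i) (simp_all add: p0 p1 h_eq c0 c1 n, simp_all add: padded_def)
  then have "represents A w (padded (x # xs) j)"
    using w by (simp add: represents_def)
  then show ?case ..
qed

lemma (in T0_model) represents_padded_elem: "represents A (padded_elem A xs j) (padded xs j)"
  unfolding padded_elem_def
proof (rule theI')
  show "\<exists>!h. represents A h (padded xs j)"
    using padded_ex represents_unique by blast
qed

end

theory Submission
  imports Defs
begin

text \<open>
  A T + min term with oracles \<open>F\<close> and \<open>G\<close> of type 2 may call the oracles infinitely often one after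
  the other, because of minimisation, but the nesting of calls inside the arguments of other calls is
  well-founded, whatever the answers are; a reducibility argument shows this. On the other hand, for a
  path \<open>x\<close> let \<open>F\<close> return the value of its argument at the point where it leaves \<open>x\<close>, so that
  exactly the prefixes of \<open>x\<close> are internal nodes of the Kohlenbach tree of \<open>F\<close>, and let \<open>G\<close> return
  a number \<open>w\<close> on the functions that bar recursion feeds to it, and 0 on all functions that are
  recognisably different. Then bar recursion yields \<open>w\<close> at the root. A computation that terminates
  for the path \<open>x\<close> and \<open>w = 0\<close> inspects only finitely many numbers. If the path is extended by a
  fresh number \<open>c\<close> and \<open>w\<close> is fresh, the result can change only if one of the finitely many arguments
  \<open>p\<close> of calls of \<open>G\<close> has the value \<open>w\<close> at \<open>c\<close>, so the nested computation \<open>p c\<close> must find \<open>w\<close> in turn.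
  Iterating this yields an infinite chain of nested computations.
\<close>

section \<open>A weak head machine with two oracles\<close>

text \<open>\<open>VOracle True\<close> stands for \<open>F\<close> and \<open>VOracle False\<close> for \<open>G\<close>; \<open>VMin f n\<close> is the search for a zero
  of \<open>f\<close> from \<open>n\<close> on.\<close>

datatype val = VC cnst | VClo tm "val list" | VApp val val | VOracle bool | VMin val nat

abbreviation VNum :: "nat \<Rightarrow> val" where
  "VNum n \<equiv> VC (Numeral n)"

text \<open>An outcome describes only the next action: \<open>Bind u k\<close> needs the number
  computed by \<open>u\<close>, and \<open>Ask b p\<close> calls an oracle on the function whose
  value at \<open>n\<close> is computed by \<open>p n\<close>. Evaluation and nesting of calls can
  thus be read off the same \<open>step\<close>.\<close>

datatype outcome = Ret nat | Tau val | Bind val "nat \<Rightarrow> val" | Ask bool "nat \<Rightarrow> val" | Stuck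

fun rec_val :: "val \<Rightarrow> val \<Rightarrow> nat \<Rightarrow> val" where
  "rec_val X F 0 = X"
| "rec_val X F (Suc n) = VApp (VApp F (rec_val X F n)) (VNum n)"

text \<open>Only applications that complete a redex are listed; in all other cases
  \<open>step\<close> works inside the function part. The two never compete, by
  \<open>delta_SomeD\<close>.\<close>

fun delta :: "val \<Rightarrow> val \<Rightarrow> outcome option" where
  "delta (VClo (Lam \<sigma> M) e) a = Some (Tau (VClo M (a # e)))"
| "delta (VC Succ) a = Some (Bind a (\<lambda>n. VNum (n + 1)))"
| "delta (VC Pred) a = Some (Bind a (\<lambda>n. VNum (n - 1)))"
| "delta (VApp (VApp (VC Ifzero) a) b) c = Some (Bind a (\<lambda>n. if n = 0 then b else c))"
| "delta (VApp (VApp (VC (Rec \<sigma>)) X) F) a = Some (Bind a (rec_val X F))"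
| "delta (VApp (VC Min) F) a = Some (Bind a (VMin F))"
| "delta (VOracle b) a = Some (Ask b (\<lambda>n. VApp a (VNum n)))"
| "delta _ _ = None"

fun step :: "val \<Rightarrow> outcome" where
  "step (VC c) = (case c of Numeral n \<Rightarrow> Ret n | _ \<Rightarrow> Stuck)"
| "step (VClo M e) = (case M of Var i \<Rightarrow> Tau (e ! i) | Cn c \<Rightarrow> Tau (VC c) | Lam \<sigma> P \<Rightarrow> Stuck
     | P \<^bold>\<cdot> Q \<Rightarrow> Tau (VApp (VClo P e) (VClo Q e)))"
| "step (VApp v a) = (case delta v a of Some r \<Rightarrow> r | None \<Rightarrow>
     (case step v of Tau v' \<Rightarrow> Tau (VApp v' a) | Bind u k \<Rightarrow> Bind u (\<lambda>n. VApp (k n) a) | _ \<Rightarrow> Stuck))"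
| "step (VOracle b) = Stuck"
| "step (VMin f n) = Bind (VApp f (VNum n)) (\<lambda>i. if i = 0 then VNum n else VMin f (Suc n))"

lemma delta_SomeD: "delta v a = Some r \<Longrightarrow> step v = Stuck"
  by (cases "(v, a)" rule: delta.cases) auto

lemma delta_step: "delta v a = Some r \<Longrightarrow> step (VApp v a) = r"
  by simp

lemma step_VApp_Tau: "step v = Tau v' \<Longrightarrow> step (VApp v a) = Tau (VApp v' a)"
  and step_VApp_Bind: "step v = Bind u k \<Longrightarrow> step (VApp v a) = Bind u (\<lambda>n. VApp (k n) a)"
  by (cases "delta v a"; auto dest: delta_SomeD)+

section \<open>The adversary's oracles\<close>

text \<open>The index \<open>k\<close> is the position of \<open>g\<close> compared with the first
  entry of the remaining path. After a complete match, the value at the next position is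
  returned.\<close>

fun exit_value :: "nat list \<Rightarrow> nat \<Rightarrow> (nat \<Rightarrow> nat) \<Rightarrow> nat" where
  "exit_value [] k g = g k"
| "exit_value (a # x) k g = (if g k = a then exit_value x (Suc k) g else g k)"

text \<open>Recognises \<open>g\<close> as the function that bar recursion feeds to \<open>G\<close>
  at the node \<open>take i x\<close>. Child 0 is off the path, hence a leaf with the value required
  of leaves; the child on the path, if there is one, already carries \<open>w\<close>.\<close>

definition hit :: "nat list \<Rightarrow> nat \<Rightarrow> (nat \<Rightarrow> nat) \<Rightarrow> nat \<Rightarrow> bool" where
  "hit x w g i \<longleftrightarrow> g 0 = 2 * list_encode (take i x @ [0]) + 1 \<and> (i < length x \<longrightarrow> g (x ! i) = w)"

definition answer :: "bool \<Rightarrow> nat list \<Rightarrow> nat \<Rightarrow> (nat \<Rightarrow> nat) \<Rightarrow> nat" where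
  "answer b x w g = (if b then exit_value x 0 g else if \<exists>i\<le>length x. hit x w g i then w else 0)"

text \<open>A finite set containing all positions at which \<open>answer\<close> inspects its
  argument.\<close>

definition queries :: "bool \<Rightarrow> nat list \<Rightarrow> nat set" where
  "queries b x = (if b then {..length x} else insert 0 (set x))"

text \<open>A call evaluates its argument at the queried positions only and leaves \<open>g\<close>
  arbitrary elsewhere. This is weaker than the totality that the interpretation demands of an
  abstraction, and it makes a terminating run a finite object.\<close>

inductive runs :: "nat list \<Rightarrow> nat \<Rightarrow> val \<Rightarrow> nat \<Rightarrow> bool" for x w where
  runs_Ret: "step v = Ret n \<Longrightarrow> runs x w v n"
| runs_Tau: "step v = Tau v' \<Longrightarrow> runs x w v' n \<Longrightarrow> runs x w v n"
| runs_Bind: "step v = Bind u k \<Longrightarrow> runs x w u i \<Longrightarrow> runs x w (k i) n \<Longrightarrow> runs x w v n"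
| runs_Ask: "step v = Ask b p \<Longrightarrow> (\<And>i. i \<in> queries b x \<Longrightarrow> runs x w (p i) (g i)) \<Longrightarrow>
    runs x w v (answer b x w g)"

text \<open>\<open>nested v p\<close>: for some, not necessarily consistent, answers of the oracles, the evaluation of
  \<open>v\<close> contains an oracle call with argument \<open>p\<close>, possibly inside the arguments of other calls.\<close>

inductive nested :: "val \<Rightarrow> (nat \<Rightarrow> val) \<Rightarrow> bool" where
  nested_Tau: "step v = Tau v' \<Longrightarrow> nested v' q \<Longrightarrow> nested v q"
| nested_Bind1: "step v = Bind u k \<Longrightarrow> nested u q \<Longrightarrow> nested v q"
| nested_Bind2: "step v = Bind u k \<Longrightarrow> nested (k i) q \<Longrightarrow> nested v q"
| nested_Ask: "step v = Ask b p \<Longrightarrow> nested v p"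
| nested_Ask_arg: "step v = Ask b p \<Longrightarrow> nested (p i) q \<Longrightarrow> nested v q"

text \<open>This is well-foundedness of nesting, not termination: a search may make infinitely many
  calls in sequence. Neither a path nor a number \<open>w\<close> occurs in it, so both may change
  during a descent.\<close>

inductive lwf :: "val \<Rightarrow> bool" where
  lwfI: "(\<And>p i. nested v p \<Longrightarrow> lwf (p i)) \<Longrightarrow> lwf v"

lemma lwfD: "lwf v \<Longrightarrow> nested v p \<Longrightarrow> lwf (p i)"
  by (auto elim: lwf.cases)

section \<open>Evaluation unfolded along one machine step\<close>

lemma runs_Ret_iff: "step v = Ret n \<Longrightarrow> runs x w v m \<longleftrightarrow> m = n"
  by (auto elim: runs.cases intro: runs_Ret)

lemma runs_Tau_iff: "step v = Tau v' \<Longrightarrow> runs x w v m \<longleftrightarrow> runs x w v' m"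
  by (auto elim: runs.cases intro: runs_Tau)

lemma runs_Bind_iff:
  assumes "step v = Bind u k"
  shows "runs x w v m \<longleftrightarrow> (\<exists>i. runs x w u i \<and> runs x w (k i) m)"
proof
  assume "runs x w v m"
  then show "\<exists>i. runs x w u i \<and> runs x w (k i) m"
    by cases (use assms in auto)
qed (use assms in \<open>auto intro: runs_Bind\<close>)

lemma runs_Ask_iff:
  assumes "step v = Ask b p"
  shows "runs x w v m \<longleftrightarrow>
    (\<exists>g. (\<forall>i\<in>queries b x. runs x w (p i) (g i)) \<and> m = answer b x w g)"
proof
  assume "runs x w v m"
  then show "\<exists>g. (\<forall>i\<in>queries b x. runs x w (p i) (g i)) \<and> m = answer b x w g"
    by cases (use assms in auto)
qed (use assms in \<open>auto intro: runs_Ask\<close>)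

section \<open>How the answers of the oracles react to a longer path\<close>

lemma exit_value_eq:
  assumes "i \<le> length x" "\<And>j. j < i \<Longrightarrow> g (k + j) = x ! j" "i = length x \<or> g (k + i) \<noteq> x ! i"
  shows "exit_value x k g = g (k + i)"
  using assms
proof (induction x arbitrary: i k)
  case (Cons a x)
  show ?case
  proof (cases i)
    case (Suc j)
    then have "exit_value x (Suc k) g = g (Suc k + j)"
      using Cons.prems(1,3) Cons.prems(2)[of "Suc _"] by (intro Cons.IH) auto
    then show ?thesis using Cons.prems(2)[of 0] Suc by simp
  qed (use Cons.prems in auto)
qed auto

text \<open>The least disagreement of \<open>g\<close> with the path exists because the end of the
  path counts as one.\<close>

lemma exit_value_index:
  obtains i where "i \<le> length x" "\<forall>j<i. g j = x ! j" "i = length x \<or> g i \<noteq> x ! i"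
    "exit_value x 0 g = g i"
proof -
  define i where "i = (LEAST i. i = length x \<or> g i \<noteq> x ! i)"
  have i: "i = length x \<or> g i \<noteq> x ! i"
    unfolding i_def by (rule LeastI[of _ "length x"]) simp
  have le: "i \<le> length x"
    unfolding i_def by (rule Least_le) simp
  have lt: "g j = x ! j" if "j < i" for j
    using not_less_Least[of j "\<lambda>i. i = length x \<or> g i \<noteq> x ! i"] that unfolding i_def by blast
  show thesis
    using exit_value_eq[of i x g 0] i le lt by (intro that) auto
qed

lemma member_le_list_encode: "a \<in> set xs \<Longrightarrow> a \<le> list_encode xs"
proof (induction xs)
  case (Cons b xs)
  then show ?case
    using le_prod_encode_1[of b "list_encode xs"] le_prod_encode_2[of "list_encode xs" b] by auto
qed simp

lemma queries_prefix: "prefix x y \<Longrightarrow> queries b x \<subseteq> queries b y"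
  by (auto simp: queries_def prefix_def)

text \<open>\<open>F\<close> leaves both paths at the same index, since the values inspected are at
  most \<open>B\<close> and none of them equals \<open>c\<close>. For \<open>G\<close> and nonzero
  \<open>w\<close>, a hit beyond \<open>length x\<close> would require a code of a sequence
  containing \<open>c\<close>, and a hit before it would require the value \<open>w\<close> at an
  inspected position; both exceed \<open>B\<close>. A hit at \<open>length x\<close> remains, and it
  says that \<open>g' c = w\<close>.\<close>

lemma answer_extend:
  assumes pre: "prefix (x @ [c]) y" and c: "B < c" and w: "w = 0 \<or> B < w"
    and eq: "\<And>i. i \<in> queries b x \<Longrightarrow> g' i = g i" and B: "\<And>i. i \<in> queries b x \<Longrightarrow> g i \<le> B"
  shows "answer b y w g' = answer b x 0 g \<or> \<not> b \<and> w \<noteq> 0 \<and> g' c = w"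
proof (cases b)
  case True
  obtain z where y: "y = x @ c # z" using pre by (auto simp: prefix_def)
  obtain i where i: "i \<le> length x" "\<forall>j<i. g j = x ! j" "i = length x \<or> g i \<noteq> x ! i"
    "exit_value x 0 g = g i"
    by (rule exit_value_index)
  have eq': "g' j = g j" "g j \<noteq> c" if "j \<le> length x" for j
    using eq[of j] B[of j] c that True by (auto simp: queries_def)
  have "exit_value y 0 g' = g' (0 + i)"
    using i eq' by (intro exit_value_eq) (auto simp: y nth_append)
  then show ?thesis using i eq' True by (auto simp: answer_def)
next
  case False
  obtain z where y: "y = x @ c # z" using pre by (auto simp: prefix_def)
  have eq': "g' 0 \<le> B" "\<And>j. j < length x \<Longrightarrow> g' (x ! j) \<le> B"
    using eq B False by (auto simp: queries_def)
  show ?thesis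
  proof (cases "w \<noteq> 0 \<and> (\<exists>i\<le>length y. hit y w g' i)")
    case True
    then obtain i where i: "i \<le> length y" "hit y w g' i" and "w \<noteq> 0" by blast
    have "i \<le> length x"
    proof (rule ccontr)
      assume "\<not> i \<le> length x"
      then have "c \<in> set (take i y @ [0])"
        by (cases "i - length x") (auto simp: y)
      then have "c \<le> list_encode (take i y @ [0])" by (rule member_le_list_encode)
      then show False using i(2) c eq'(1) by (auto simp: hit_def)
    qed
    moreover have "\<not> i < length x"
      using i(2) eq'(2)[of i] w \<open>w \<noteq> 0\<close> by (auto simp: hit_def y nth_append)
    ultimately have "i = length x" by simp
    then show ?thesis using i(2) \<open>w \<noteq> 0\<close> False by (auto simp: hit_def y)
  qed (use False in \<open>auto simp: answer_def\<close>)
qed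

section \<open>Stability of terminating runs and the descent through nested calls\<close>

definition found :: "(nat \<Rightarrow> val) set \<Rightarrow> nat list \<Rightarrow> nat \<Rightarrow> nat \<Rightarrow> bool" where
  "found S y w c \<longleftrightarrow> w \<noteq> 0 \<and> (\<exists>p\<in>S. runs y w (p c) w)"

text \<open>\<open>B\<close> says how fresh \<open>c\<close> and a nonzero \<open>w\<close> must be.
  The first alternative also records termination of every \<open>p c\<close>: at
  \<open>w = 0\<close>, where \<open>found\<close> is impossible, this is what keeps the descent
  going.\<close>

definition extensible :: "nat list \<Rightarrow> nat \<Rightarrow> (nat \<Rightarrow> val) set \<Rightarrow> val \<Rightarrow> nat \<Rightarrow> bool" where
  "extensible x B S v m \<longleftrightarrow> finite S \<and> m \<le> B \<and> (\<forall>p\<in>S. nested v p) \<and>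
    (\<forall>y c w m'. prefix (x @ [c]) y \<longrightarrow> B < c \<longrightarrow> w = 0 \<or> B < w \<longrightarrow> runs y w v m' \<longrightarrow>
       m' = m \<and> (\<forall>p\<in>S. \<exists>k. runs y w (p c) k) \<or> found S y w c)"

lemma extensibleD:
  assumes "extensible x B S v m"
  shows "finite S" "m \<le> B" "p \<in> S \<Longrightarrow> nested v p"
    and "prefix (x @ [c]) y \<Longrightarrow> B < c \<Longrightarrow> w = 0 \<or> B < w \<Longrightarrow> runs y w v m' \<Longrightarrow>
       m' = m \<and> (\<forall>p\<in>S. \<exists>k. runs y w (p c) k) \<or> found S y w c"
  using assms unfolding extensible_def by blast+

text \<open>Induction on the run, which branches finitely. At a call of \<open>G\<close> its
  argument \<open>p\<close> joins the set: the new entry \<open>c\<close> is among the positions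
  queried for \<open>y\<close>, so every run for \<open>y\<close> has to evaluate
  \<open>p c\<close>.\<close>

lemma runs_extensible:
  assumes "runs x 0 v m"
  shows "\<exists>B S. extensible x B S v m"
  using assms
proof induction
  case (runs_Ret v n)
  then have "extensible x n {} v n" by (auto simp: extensible_def runs_Ret_iff)
  then show ?case by blast
next
  case (runs_Tau v v' n)
  then obtain B S where "extensible x B S v' n" by blast
  then have "extensible x B S v n"
    using runs_Tau.hyps(1) by (simp add: extensible_def runs_Tau_iff nested_Tau)
  then show ?case by blast
next
  case (runs_Bind v u k i n)
  from runs_Bind.IH obtain B S where 1: "extensible x B S u i" by blast
  from runs_Bind.IH obtain B' S' where 2: "extensible x B' S' (k i) n" by blast
  have "extensible x (max B B') (S \<union> S') v n"
    unfolding extensible_def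
  proof (intro conjI allI impI)
    show "finite (S \<union> S')" "n \<le> max B B'"
      using extensibleD(1,2)[OF 1] extensibleD(1,2)[OF 2] by auto
    show "\<forall>p\<in>S \<union> S'. nested v p"
      using extensibleD(3)[OF 1] extensibleD(3)[OF 2] runs_Bind.hyps(1)
      by (auto intro: nested_Bind1 nested_Bind2)
    fix y c w m'
    assume *: "prefix (x @ [c]) y" "max B B' < c" "w = 0 \<or> max B B' < w" and "runs y w v m'"
    then obtain i' where i': "runs y w u i'" "runs y w (k i') m'"
      using runs_Bind.hyps(1) by (auto simp: runs_Bind_iff)
    from * have "i' = i \<and> (\<forall>p\<in>S. \<exists>k. runs y w (p c) k) \<or> found S y w c"
      by (intro extensibleD(4)[OF 1 _ _ _ i'(1)]) auto
    \<comment> \<open>The new run reaches the old continuation only if the first part again returns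
      \<open>i\<close>; otherwise \<open>w\<close> has been found already.\<close>
    moreover from * have "m' = n \<and> (\<forall>p\<in>S'. \<exists>k. runs y w (p c) k) \<or> found S' y w c" if "i' = i"
      using i'(2) that by (intro extensibleD(4)[OF 2]) auto
    ultimately show "m' = n \<and> (\<forall>p\<in>S \<union> S'. \<exists>k. runs y w (p c) k) \<or> found (S \<union> S') y w c"
      unfolding found_def by blast
  qed
  then show ?case by blast
next
  case (runs_Ask v b p g)
  have "\<forall>i. \<exists>B S. i \<in> queries b x \<longrightarrow> extensible x B S (p i) (g i)"
    using runs_Ask.IH by blast
  then obtain B S where IH: "\<And>i. i \<in> queries b x \<Longrightarrow> extensible x (B i) (S i) (p i) (g i)"
    by metis
  have fin: "finite (queries b x)" by (simp add: queries_def)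
  define C where "C = max (answer b x 0 g) (Max (B ` queries b x))"
  \<comment> \<open>A call of \<open>F\<close> does not add its own argument, because its answer
    cannot change.\<close>
  define T where "T = (\<Union>i\<in>queries b x. S i) \<union> (if b then {} else {p})"
  have C: "B i \<le> C" if "i \<in> queries b x" for i
    using that fin by (auto simp: C_def intro!: Max_ge max.coboundedI2)
  have "extensible x C T v (answer b x 0 g)"
    unfolding extensible_def
  proof (intro conjI allI impI)
    show "finite T" using fin extensibleD(1)[OF IH] by (simp add: T_def)
    have "nested v q" if "i \<in> queries b x" "q \<in> S i" for i q
      using nested_Ask_arg[OF runs_Ask.hyps(1) extensibleD(3)[OF IH]] that by blast
    then show "\<forall>p\<in>T. nested v p"
      using nested_Ask[OF runs_Ask.hyps(1)] by (auto simp: T_def split: if_splits)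
    show "answer b x 0 g \<le> C" by (simp add: C_def)
    fix y c w m'
    assume *: "prefix (x @ [c]) y" "C < c" "w = 0 \<or> C < w" and "runs y w v m'"
    then obtain g' where g': "\<And>i. i \<in> queries b y \<Longrightarrow> runs y w (p i) (g' i)"
        and m': "m' = answer b y w g'"
      using runs_Ask.hyps(1) by (auto simp: runs_Ask_iff)
    have sub: "queries b x \<subseteq> queries b y"
      using *(1) by (intro queries_prefix) (auto simp: prefix_def)
    have c: "runs y w (p c) (g' c)" if "\<not> b"
      using *(1) that by (intro g') (auto simp: queries_def prefix_def)
    have i: "g' i = g i \<and> (\<forall>p\<in>S i. \<exists>k. runs y w (p c) k) \<or> found (S i) y w c"
      if "i \<in> queries b x" for i
      using * C[OF that] g'[of i] sub that by (intro extensibleD(4)[OF IH]) auto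
    show "m' = answer b x 0 g \<and> (\<forall>p\<in>T. \<exists>k. runs y w (p c) k) \<or> found T y w c"
    proof (cases "found T y w c")
      case False
      then have "\<not> found (S i) y w c" if "i \<in> queries b x" for i
        using that by (auto simp: T_def found_def)
      then have eq: "g' i = g i" and S: "\<forall>p\<in>S i. \<exists>k. runs y w (p c) k" if "i \<in> queries b x" for i
        using i[OF that] that by auto
      have "answer b y w g' = answer b x 0 g \<or> \<not> b \<and> w \<noteq> 0 \<and> g' c = w"
        using C extensibleD(2)[OF IH] eq by (intro answer_extend[OF *]) (auto intro: order_trans)
      moreover have "\<not> (\<not> b \<and> w \<noteq> 0 \<and> g' c = w)"
        using False c by (auto simp: T_def found_def)
      moreover have "\<exists>k. runs y w (q c) k" if "q \<in> T" for q
        using that S c by (auto simp: T_def split: if_splits)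
      ultimately show ?thesis using m' by blast
    qed simp
  qed
  then show ?case by blast
qed

text \<open>If \<open>p\<close> is not dense below \<open>s\<close>, then some extension
  \<open>s0\<close> and bound \<open>B0\<close> exclude it altogether, and below \<open>s0\<close>
  the other members are jointly dense. Discarding members one by one must end with a dense one,
  because the empty set is not dense.\<close>

lemma finite_union_dense:
  fixes D :: "'i \<Rightarrow> nat list \<Rightarrow> nat \<Rightarrow> bool"
  assumes "finite S" "P s"
    and "\<And>s1 B. P s1 \<Longrightarrow> prefix s s1 \<Longrightarrow> \<exists>y w. P y \<and> prefix s1 y \<and> B < w \<and> (\<exists>p\<in>S. D p y w)"
  shows "\<exists>p\<in>S. \<exists>s'. P s' \<and> prefix s s' \<and>
    (\<forall>s1 B. P s1 \<longrightarrow> prefix s' s1 \<longrightarrow> (\<exists>y w. P y \<and> prefix s1 y \<and> B < w \<and> D p y w))"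
  using assms
proof (induction S arbitrary: s)
  case empty
  then show ?case by blast
next
  case (insert p S)
  show ?case
  proof (cases "\<forall>s1 B. P s1 \<longrightarrow> prefix s s1 \<longrightarrow> (\<exists>y w. P y \<and> prefix s1 y \<and> B < w \<and> D p y w)")
    case True
    then show ?thesis using insert.prems(1) by blast
  next
    case False
    then obtain s0 B0 where s0: "P s0" "prefix s s0"
        "\<And>y w. P y \<Longrightarrow> prefix s0 y \<Longrightarrow> B0 < w \<Longrightarrow> \<not> D p y w"
      by blast
    have dense: "\<exists>y w. P y \<and> prefix s1 y \<and> B < w \<and> (\<exists>p\<in>S. D p y w)"
      if "P s1" and s1: "prefix s0 s1" for s1 B
    proof -
      obtain y w where y: "P y" "prefix s1 y" "max B B0 < w" "\<exists>q\<in>insert p S. D q y w"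
        using insert.prems(2)[OF \<open>P s1\<close> prefix_order.trans[OF s0(2) s1], of "max B B0"] by auto
      then have "\<not> D p y w"
        using s0(3)[OF y(1) prefix_order.trans[OF s1 y(2)]] y(3) by simp
      then show ?thesis using y by auto
    qed
    from insert.IH[OF s0(1) dense] obtain p' s' where "p' \<in> S" "P s'" "prefix s0 s'"
        "\<forall>s1 B. P s1 \<longrightarrow> prefix s' s1 \<longrightarrow> (\<exists>y w. P y \<and> prefix s1 y \<and> B < w \<and> D p' y w)"
      by blast
    then show ?thesis using prefix_order.trans[OF s0(2)] by blast
  qed
qed

text \<open>The tree is defined by padding with 0 and 1; with entries of at least 2, both paddings
  leave the path at once.\<close>

definition path :: "nat list \<Rightarrow> bool" where
  "path s \<longleftrightarrow> (\<forall>a\<in>set s. 2 \<le> a)"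

text \<open>One step of the descent: termination for \<open>w = 0\<close> and density of the
  successful large \<open>w\<close> pass from \<open>v\<close> to \<open>p c\<close>, for some call
  argument \<open>p\<close> nested in \<open>v\<close> and a fresh \<open>c\<close>. Induction on
  \<open>lwf\<close> turns this into a contradiction.\<close>

lemma lwf_not_dense:
  assumes "lwf v"
    and "path s"
    and "\<And>y. path y \<Longrightarrow> prefix s y \<Longrightarrow> \<exists>m. runs y 0 v m"
    and "\<And>s1 B. path s1 \<Longrightarrow> prefix s s1 \<Longrightarrow> \<exists>y w. path y \<and> prefix s1 y \<and> B < w \<and> runs y w v w"
  shows False
  using assms
proof (induction arbitrary: s)
  case (lwfI v)
  obtain m where "runs s 0 v m" using lwfI.prems by blast
  then obtain B S where ext: "extensible s B S v m" using runs_extensible by blast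
  \<comment> \<open>The summand 2 makes \<open>c\<close> exceed \<open>B\<close> and also admits it
    as an entry of a path.\<close>
  define c where "c = B + 2"
  have path: "path (s @ [c])" using lwfI.prems(1) by (auto simp: path_def c_def)
  have "\<exists>y w. path y \<and> prefix s1 y \<and> C < w \<and> (\<exists>p\<in>S. runs y w (p c) w)"
    if s1: "path s1" "prefix (s @ [c]) s1" for s1 C
  proof -
    obtain y w where y: "path y" "prefix s1 y" "max B C < w" "runs y w v w"
      using lwfI.prems(3)[of s1 "max B C"] s1 by (auto dest: append_prefixD)
    \<comment> \<open>The other alternative would give \<open>w = m\<close>, whereas
      \<open>m \<le> B < w\<close>.\<close>
    then have "\<exists>p\<in>S. runs y w (p c) w"
      using extensibleD(4)[OF ext, of c y w w] extensibleD(2)[OF ext] s1(2)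
      by (auto simp: c_def found_def)
    then show ?thesis using y by auto
  qed
  from finite_union_dense[where P = path and D = "\<lambda>p y w. runs y w (p c) w", OF extensibleD(1)[OF ext] path this]
  obtain p s' where p: "p \<in> S" "path s'" "prefix (s @ [c]) s'"
    and dense: "\<And>s1 B. path s1 \<Longrightarrow> prefix s' s1 \<Longrightarrow>
      \<exists>y w. path y \<and> prefix s1 y \<and> B < w \<and> runs y w (p c) w"
    by blast
  show False
  proof (rule lwfI.IH[OF extensibleD(3)[OF ext p(1)] p(2) _ dense])
    fix y assume y: "path y" "prefix s' y"
    then have "prefix (s @ [c]) y" using p(3) by auto
    moreover from this obtain m' where "runs y 0 v m'"
      using lwfI.prems(2)[of y] y by (auto dest: append_prefixD)
    \<comment> \<open>At \<open>w = 0\<close> nothing counts as found, so the first alternative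
      supplies the termination of \<open>p c\<close>.\<close>
    ultimately show "\<exists>m. runs y 0 (p c) m" using extensibleD(4)[OF ext, of c y 0 m'] p(1) by (auto simp: c_def found_def)
  qed
qed

section \<open>The logical relation\<close>

text \<open>The ground case joins a reducibility predicate, \<open>lwf\<close>, with equality of
  results for all paths and all \<open>w\<close>. The second half makes it possible to replace terms
  by their normal forms.\<close>

fun lrel :: "ty \<Rightarrow> val \<Rightarrow> val \<Rightarrow> bool" where
  "lrel Nty v u \<longleftrightarrow> lwf v \<and> lwf u \<and> (\<forall>x w m. runs x w v m \<longleftrightarrow> runs x w u m)"
| "lrel (\<sigma> \<^bold>\<rightarrow> \<tau>) v u \<longleftrightarrow> (\<forall>a b. lrel \<sigma> a b \<longrightarrow> lrel \<tau> (VApp v a) (VApp u b))"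

declare lrel.simps [simp del]

lemma lrel_funI:
  "(\<And>a b. lrel \<sigma> a b \<Longrightarrow> lrel \<tau> (VApp v a) (VApp u b)) \<Longrightarrow> lrel (\<sigma> \<^bold>\<rightarrow> \<tau>) v u"
  by (simp add: lrel.simps)

lemma lrel_VApp: "lrel (\<sigma> \<^bold>\<rightarrow> \<tau>) v u \<Longrightarrow> lrel \<sigma> a b \<Longrightarrow> lrel \<tau> (VApp v a) (VApp u b)"
  by (simp add: lrel.simps)

lemma lrel_NtyI:
  "lwf v \<Longrightarrow> lwf u \<Longrightarrow> (\<And>x w m. runs x w v m \<longleftrightarrow> runs x w u m) \<Longrightarrow> lrel Nty v u"
  by (simp add: lrel.simps)

lemma lrel_NtyD:
  assumes "lrel Nty v u"
  shows "lwf v" "lwf u" "runs x w v m \<longleftrightarrow> runs x w u m"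
  using assms by (simp_all add: lrel.simps)

lemma lrel_sym: "lrel \<tau> v u \<Longrightarrow> lrel \<tau> u v"
  by (induction \<tau> arbitrary: v u) (auto simp: lrel.simps)

lemma lrel_trans: "lrel \<tau> v u \<Longrightarrow> lrel \<tau> u t \<Longrightarrow> lrel \<tau> v t"
proof (induction \<tau> arbitrary: v u t)
  case Nty
  then show ?case by (simp add: lrel.simps)
next
  case (Arrow \<sigma> \<tau>)
  show ?case
  proof (rule lrel_funI)
    fix a b assume ab: "lrel \<sigma> a b"
    then have "lrel \<sigma> b b" using Arrow.IH(1) lrel_sym by blast
    then show "lrel \<tau> (VApp v a) (VApp t b)"
      using Arrow.IH(2) lrel_VApp[OF Arrow.prems(1) ab] lrel_VApp[OF Arrow.prems(2)] by blast
  qed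
qed

lemma lwf_Ret: "step v = Ret n \<Longrightarrow> lwf v"
  by (rule lwfI) (auto elim: nested.cases)

lemma lwf_Tau:
  assumes "step v = Tau v'" "lwf v'"
  shows "lwf v"
proof (rule lwfI)
  fix p i
  assume "nested v p"
  then show "lwf (p i)" by cases (use assms lwfD in auto)
qed

lemma lwf_Bind:
  assumes "step v = Bind u k" "lwf u" "\<And>i. lwf (k i)"
  shows "lwf v"
proof (rule lwfI)
  fix p i
  assume "nested v p"
  then show "lwf (p i)" by cases (use assms lwfD in auto)
qed

lemma lwf_Ask:
  assumes "step v = Ask b p" "\<And>i. lwf (p i)"
  shows "lwf v"
proof (rule lwfI)
  fix q i
  assume "nested v q"
  then show "lwf (q i)" by cases (use assms lwfD in auto)
qed

lemma lrel_Tau: "step v = Tau v' \<Longrightarrow> lrel \<tau> v' u \<Longrightarrow> lrel \<tau> v u"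
proof (induction \<tau> arbitrary: v v' u)
  case Nty
  show ?case
    using lwf_Tau[OF Nty(1)] lrel_NtyD[OF Nty(2)] by (intro lrel_NtyI) (simp_all add: runs_Tau_iff[OF Nty(1)])
next
  case (Arrow \<sigma> \<tau>)
  show ?case
    by (rule lrel_funI, rule Arrow.IH(2)[OF step_VApp_Tau[OF Arrow.prems(1)] lrel_VApp[OF Arrow.prems(2)]])
qed

lemma lrel_Tau2: "step v = Tau v' \<Longrightarrow> step u = Tau u' \<Longrightarrow> lrel \<tau> v' u' \<Longrightarrow> lrel \<tau> v u"
  using lrel_Tau lrel_sym by blast

lemma lrel_VNum: "lrel Nty (VNum n) (VNum n)"
  by (intro lrel_NtyI lwf_Ret) auto

text \<open>The continuations must be related at every number, even at one never returned, because
  \<open>nested\<close> admits arbitrary answers.\<close>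

lemma lrel_Bind:
  assumes "step v = Bind a k" "step u = Bind b l" "lrel Nty a b" "\<And>i. lrel \<tau> (k i) (l i)"
  shows "lrel \<tau> v u"
  using assms
proof (induction \<tau> arbitrary: v u k l)
  case Nty
  have "lwf v" "lwf u"
    using lwf_Bind[OF Nty(1)] lwf_Bind[OF Nty(2)] lrel_NtyD(1,2)[OF Nty(3)] lrel_NtyD(1,2)[OF Nty(4)]
    by blast+
  then show ?case
    using Nty(1,2) lrel_NtyD(3)[OF Nty(3)] lrel_NtyD(3)[OF Nty(4)]
    by (intro lrel_NtyI) (simp_all add: runs_Bind_iff)
next
  case (Arrow \<sigma> \<tau>)
  show ?case
  proof (rule lrel_funI)
    fix a' b' assume "lrel \<sigma> a' b'"
    then show "lrel \<tau> (VApp v a') (VApp u b')"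
      by (intro Arrow.IH(2)[OF step_VApp_Bind[OF Arrow.prems(1)] step_VApp_Bind[OF Arrow.prems(2)]
            Arrow.prems(3)] lrel_VApp[OF Arrow.prems(4)])
  qed
qed

text \<open>A one-sided variant that identifies recursion at a numeral with its unfolding
  \<open>rec_val\<close>. Self-relatedness of all \<open>k i\<close> is there for the
  \<open>lwf\<close> part.\<close>

lemma lrel_Bind_VNum:
  assumes "step v = Bind a k" "lrel Nty a (VNum n)" "\<And>i. lrel \<tau> (k i) (k i)" "lrel \<tau> (k n) u"
  shows "lrel \<tau> v u"
  using assms
proof (induction \<tau> arbitrary: v u k)
  case Nty
  have "lwf v"
    using lwf_Bind[OF Nty(1)] lrel_NtyD(1)[OF Nty(2)] lrel_NtyD(1)[OF Nty(3)] by blast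
  moreover have "runs x w v m \<longleftrightarrow> runs x w u m" for x w m
    using Nty(1) lrel_NtyD(3)[OF Nty(2)] lrel_NtyD(3)[OF Nty(4)]
    by (simp add: runs_Bind_iff runs_Ret_iff)
  ultimately show ?case using lrel_NtyD(2)[OF Nty(4)] by (intro lrel_NtyI)
next
  case (Arrow \<sigma> \<tau>)
  show ?case
  proof (rule lrel_funI)
    fix a' b' assume ab: "lrel \<sigma> a' b'"
    then have "lrel \<sigma> a' a'" using lrel_sym lrel_trans by blast
    then show "lrel \<tau> (VApp v a') (VApp u b')"
      using ab by (intro Arrow.IH(2)[OF step_VApp_Bind[OF Arrow.prems(1)] Arrow.prems(2)]
          lrel_VApp[OF Arrow.prems(3)] lrel_VApp[OF Arrow.prems(4)])
  qed
qed

lemma lrel_rec_val: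
  assumes "lrel \<sigma> X X'" "lrel (\<sigma> \<^bold>\<rightarrow> Nty \<^bold>\<rightarrow> \<sigma>) F F'"
  shows "lrel \<sigma> (rec_val X F n) (rec_val X' F' n)"
proof (induction n)
  case (Suc n)
  then show ?case using lrel_VApp[OF lrel_VApp[OF assms(2) Suc] lrel_VNum] by simp
qed (use assms in simp)

text \<open>The search may go on forever, so no measure on \<open>n\<close> is available; but a
  derivation of \<open>nested\<close> unfolds it only finitely often.\<close>

lemma nested_VMin:
  assumes "nested v q" "v = VMin f n" "\<And>n. lwf (VApp f (VNum n))"
  shows "lwf (q i)"
  using assms(1,2)
proof (induction arbitrary: n)
  case (nested_Bind1 v u k q)
  then have "nested (VApp f (VNum n)) q" by simp
  then show ?case using lwfD[OF assms(3)] by blast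
next
  case (nested_Bind2 v u k j q)
  have "\<not> nested (VNum n) q" by (auto elim: nested.cases)
  then show ?case using nested_Bind2 by (auto simp del: step.simps simp: step.simps(5) split: if_splits)
qed (simp_all del: step.simps add: step.simps(5))

lemma runs_VMin:
  assumes "runs x w v m" "v = VMin f n"
    and fg: "\<And>n m. runs x w (VApp f (VNum n)) m \<Longrightarrow> runs x w (VApp g (VNum n)) m"
  shows "runs x w (VMin g n) m"
  using assms(1,2)
proof (induction arbitrary: n)
  case (runs_Bind v u k i m)
  have "u = VApp f (VNum n)" and k: "k = (\<lambda>i. if i = 0 then VNum n else VMin f (Suc n))"
    using runs_Bind.hyps(1) runs_Bind.prems by simp_all
  then have "runs x w (VApp g (VNum n)) i" using runs_Bind.hyps(2) fg by simp
  moreover have "runs x w (if i = 0 then VNum n else VMin g (Suc n)) m"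
    using runs_Bind.hyps(3) runs_Bind.IH(2)[of "Suc n"] by (cases "i = 0") (simp_all add: k)
  ultimately show ?case by (rule runs.runs_Bind[OF step.simps(5)])
qed (simp_all del: step.simps add: step.simps(5))

lemma lrel_VMin:
  assumes "lrel (Nty \<^bold>\<rightarrow> Nty) f g"
  shows "lrel Nty (VMin f n) (VMin g n)"
proof (rule lrel_NtyI)
  note fg = lrel_VApp[OF assms lrel_VNum]
  show "lwf (VMin f n)" by (rule lwfI) (rule nested_VMin[OF _ refl lrel_NtyD(1)[OF fg]])
  show "lwf (VMin g n)" by (rule lwfI) (rule nested_VMin[OF _ refl lrel_NtyD(2)[OF fg]])
  show "runs x w (VMin f n) m \<longleftrightarrow> runs x w (VMin g n) m" for x w m
    using runs_VMin[OF _ refl, of x w f n m g] runs_VMin[OF _ refl, of x w g n m f]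
      lrel_NtyD(3)[OF fg] by blast
qed

lemma lrel_VOracle: "lrel ((Nty \<^bold>\<rightarrow> Nty) \<^bold>\<rightarrow> Nty) (VOracle b) (VOracle b)"
proof (rule lrel_funI)
  fix v u assume "lrel (Nty \<^bold>\<rightarrow> Nty) v u"
  note vu = lrel_VApp[OF this lrel_VNum]
  have s: "step (VApp (VOracle b) v) = Ask b (\<lambda>n. VApp v (VNum n))" for v by simp
  show "lrel Nty (VApp (VOracle b) v) (VApp (VOracle b) u)"
    using lrel_NtyD[OF vu]
    by (intro lrel_NtyI lwf_Ask[OF s]) (simp_all only: runs_Ask_iff[OF s])
qed

text \<open>Once fully applied, each constant other than a numeral reads one number by
  \<open>Bind\<close> and goes on with related values. For recursion, an induction on that number
  remains.\<close>

lemma lrel_cnst: "lrel (cnst_ty c) (VC c) (VC c)"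
proof (cases c)
  case Numeral
  then show ?thesis using lrel_VNum by simp
next
  case Succ
  show ?thesis unfolding Succ cnst_ty.simps
    by (intro lrel_funI, rule lrel_Bind[where k = "\<lambda>n. VNum (n + 1)" and l = "\<lambda>n. VNum (n + 1)"])
      (auto intro: lrel_VNum)
next
  case Pred
  show ?thesis unfolding Pred cnst_ty.simps
    by (intro lrel_funI, rule lrel_Bind[where k = "\<lambda>n. VNum (n - 1)" and l = "\<lambda>n. VNum (n - 1)"])
      (auto intro: lrel_VNum)
next
  case Ifzero
  show ?thesis unfolding Ifzero cnst_ty.simps
    by (intro lrel_funI, rule lrel_Bind[OF delta_step delta_step, OF delta.simps(4) delta.simps(4)]) auto
next
  case (Rec \<sigma>)
  show ?thesis unfolding Rec cnst_ty.simps
    by (intro lrel_funI, rule lrel_Bind[OF delta_step delta_step, OF delta.simps(5) delta.simps(5)])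
      (auto intro: lrel_rec_val)
next
  case Min
  show ?thesis unfolding Min cnst_ty.simps
    by (intro lrel_funI, rule lrel_Bind[OF delta_step delta_step, OF delta.simps(6) delta.simps(6)])
      (auto intro: lrel_VMin)
qed

section \<open>Typed terms in related environments\<close>

definition env_rel :: "ty list \<Rightarrow> val list \<Rightarrow> val list \<Rightarrow> bool" where
  "env_rel \<Gamma> e e' \<longleftrightarrow> length e = length \<Gamma> \<and> length e' = length \<Gamma> \<and>
     (\<forall>i<length \<Gamma>. lrel (\<Gamma> ! i) (e ! i) (e' ! i))"

lemma env_rel_Cons: "env_rel (\<sigma> # \<Gamma>) (a # e) (b # e') \<longleftrightarrow> lrel \<sigma> a b \<and> env_rel \<Gamma> e e'"
  by (auto simp: env_rel_def less_Suc_eq_0_disj)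

lemma env_rel_Nil: "env_rel [] [] []"
  by (simp add: env_rel_def)

lemma env_rel_sym: "env_rel \<Gamma> e e' \<Longrightarrow> env_rel \<Gamma> e' e"
  by (auto simp: env_rel_def intro: lrel_sym)

lemma env_rel_refl: "env_rel \<Gamma> e e' \<Longrightarrow> env_rel \<Gamma> e e" "env_rel \<Gamma> e e' \<Longrightarrow> env_rel \<Gamma> e' e'"
  unfolding env_rel_def using lrel_sym lrel_trans by blast+

lemma env_rel_append:
  "env_rel \<Gamma>1 e1 e1' \<Longrightarrow> env_rel \<Gamma>2 e2 e2' \<Longrightarrow> env_rel (\<Gamma>1 @ \<Gamma>2) (e1 @ e2) (e1' @ e2')"
  by (auto simp: env_rel_def nth_append)

inductive_cases has_ty_VarE: "has_ty \<Gamma> (Var i) \<tau>"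
inductive_cases has_ty_CnE: "has_ty \<Gamma> (Cn c) \<tau>"
inductive_cases has_ty_LamE: "has_ty \<Gamma> (Lam \<sigma> M) \<tau>"
inductive_cases has_ty_AppE: "has_ty \<Gamma> (M \<^bold>\<cdot> P) \<tau>"

lemma lrel_Lam:
  assumes "\<And>a b. lrel \<sigma> a b \<Longrightarrow> lrel \<tau> (VClo M (a # e)) (VClo M' (b # e'))"
  shows "lrel (\<sigma> \<^bold>\<rightarrow> \<tau>) (VClo (Lam \<sigma> M) e) (VClo (Lam \<sigma>' M') e')"
  by (rule lrel_funI, rule lrel_Tau2[OF _ _ assms]) auto

lemma lrel_App:
  assumes "lrel (\<sigma> \<^bold>\<rightarrow> \<tau>) (VClo M e) (VClo M' e')" "lrel \<sigma> (VClo P e) (VClo P' e')"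
  shows "lrel \<tau> (VClo (M \<^bold>\<cdot> P) e) (VClo (M' \<^bold>\<cdot> P') e')"
  by (rule lrel_Tau2[OF _ _ lrel_VApp[OF assms]]) auto

text \<open>At type \<open>Nty\<close> this yields \<open>lwf\<close> of the closure, so nesting of
  calls is well-founded for every typed term in a reducible environment.\<close>

lemma fundamental:
  "has_ty \<Gamma> M \<tau> \<Longrightarrow> env_rel \<Gamma> e e' \<Longrightarrow> lrel \<tau> (VClo M e) (VClo M e')"
proof (induction arbitrary: e e' rule: has_ty.induct)
  case (ty_Var i \<Gamma>)
  show ?case by (rule lrel_Tau2[of _ "e ! i" _ "e' ! i"]) (use ty_Var in \<open>auto simp: env_rel_def\<close>)
next
  case (ty_Cn \<Gamma> c)
  show ?case by (rule lrel_Tau2[OF _ _ lrel_cnst]) auto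
next
  case (ty_Lam \<sigma> \<Gamma> M \<tau>)
  then show ?case by (intro lrel_Lam) (auto simp: env_rel_Cons)
next
  case (ty_App \<Gamma> M \<sigma> \<tau> P)
  then show ?case by (blast intro: lrel_App)
qed

section \<open>Lifting, substitution and conversion\<close>

lemma has_ty_lift:
  "has_ty (\<Gamma>1 @ \<Gamma>2) M \<tau> \<Longrightarrow> has_ty (\<Gamma>1 @ \<sigma> # \<Gamma>2) (lift (length \<Gamma>1) M) \<tau>"
proof (induction "\<Gamma>1 @ \<Gamma>2" M \<tau> arbitrary: \<Gamma>1 rule: has_ty.induct)
  case (ty_Var i)
  have "has_ty (\<Gamma>1 @ \<sigma> # \<Gamma>2) (Var i) ((\<Gamma>1 @ \<sigma> # \<Gamma>2) ! i)" if "i < length \<Gamma>1"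
    using that by (intro has_ty.ty_Var) simp
  moreover have "has_ty (\<Gamma>1 @ \<sigma> # \<Gamma>2) (Var (Suc i)) ((\<Gamma>1 @ \<sigma> # \<Gamma>2) ! Suc i)"
    using ty_Var by (intro has_ty.ty_Var) simp
  ultimately show ?case by (auto simp: nth_append Suc_diff_le not_less)
next
  case (ty_Cn c)
  then show ?case by (simp add: has_ty.ty_Cn)
next
  case (ty_Lam \<rho> M \<tau>)
  then show ?case using ty_Lam(2)[of "\<rho> # \<Gamma>1"] by (simp add: has_ty.ty_Lam)
next
  case (ty_App M \<rho> \<tau> P)
  then show ?case by (simp add: has_ty.ty_App[of _ _ \<rho>])
qed

lemma has_ty_subst:
  "has_ty (\<Gamma>1 @ \<sigma> # \<Gamma>2) M \<tau> \<Longrightarrow> has_ty (\<Gamma>1 @ \<Gamma>2) P \<sigma> \<Longrightarrow>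
    has_ty (\<Gamma>1 @ \<Gamma>2) (subst (length \<Gamma>1) P M) \<tau>"
proof (induction "\<Gamma>1 @ \<sigma> # \<Gamma>2" M \<tau> arbitrary: \<Gamma>1 P rule: has_ty.induct)
  case (ty_Var i)
  have "has_ty (\<Gamma>1 @ \<Gamma>2) (Var i) (\<Gamma>1 ! i)" if "i < length \<Gamma>1"
    using has_ty.ty_Var[of i "\<Gamma>1 @ \<Gamma>2"] that by (simp add: nth_append)
  moreover have "has_ty (\<Gamma>1 @ \<Gamma>2) (Var (i - 1)) (\<Gamma>2 ! (i - Suc (length \<Gamma>1)))" if "length \<Gamma>1 < i"
    using has_ty.ty_Var[of "i - 1" "\<Gamma>1 @ \<Gamma>2"] that ty_Var
    by (cases i) (auto simp: nth_append)
  ultimately show ?case using ty_Var by (auto simp: nth_append nth_Cons')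
next
  case (ty_Cn c)
  then show ?case by (simp add: has_ty.ty_Cn)
next
  case (ty_Lam \<rho> M \<tau>)
  then show ?case
    using ty_Lam(2)[of "\<rho> # \<Gamma>1" "lift 0 P"] has_ty_lift[of "[]" "\<Gamma>1 @ \<Gamma>2" P \<sigma> \<rho>]
    by (simp add: has_ty.ty_Lam)
next
  case (ty_App M \<rho> \<tau> P)
  then show ?case by (simp add: has_ty.ty_App[of _ _ \<rho>])
qed

text \<open>The inserted value \<open>a\<close> is unrestricted, since no variable of the lifted
  term refers to it.\<close>

lemma lrel_lift:
  "has_ty (\<Gamma>1 @ \<Gamma>2) M \<tau> \<Longrightarrow> env_rel \<Gamma>1 e1 e1' \<Longrightarrow> env_rel \<Gamma>2 e2 e2' \<Longrightarrow>
    lrel \<tau> (VClo (lift (length \<Gamma>1) M) (e1 @ a # e2)) (VClo M (e1' @ e2'))"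
proof (induction "\<Gamma>1 @ \<Gamma>2" M \<tau> arbitrary: \<Gamma>1 e1 e1' rule: has_ty.induct)
  case (ty_Var i)
  let ?i = "if i < length \<Gamma>1 then i else Suc i"
  have "lrel ((\<Gamma>1 @ \<Gamma>2) ! i) ((e1 @ a # e2) ! ?i) ((e1' @ e2') ! i)"
    using ty_Var by (auto simp: env_rel_def nth_append Suc_diff_le not_less)
  then show ?case by (rule lrel_Tau2[rotated 2]) auto
next
  case (ty_Cn c)
  show ?case by (rule lrel_Tau2[OF _ _ lrel_cnst]) auto
next
  case (ty_Lam \<rho> M \<tau>)
  show ?case
    using ty_Lam(2)[of "\<rho> # \<Gamma>1" "_ # e1" "_ # e1'"] ty_Lam(3,4)
    by (auto intro!: lrel_Lam simp: env_rel_Cons)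
next
  case (ty_App M \<rho> \<tau> P)
  then show ?case by (simp add: lrel_App[of \<rho>])
qed

text \<open>Substituting \<open>P\<close> amounts to storing its closure. Allowing any related
  \<open>a\<close> lets the induction pass under binders, where the closure becomes that of the
  lifted \<open>P\<close> in a longer environment.\<close>

lemma lrel_subst:
  "has_ty (\<Gamma>1 @ \<sigma> # \<Gamma>2) M \<tau> \<Longrightarrow> has_ty (\<Gamma>1 @ \<Gamma>2) P \<sigma> \<Longrightarrow>
    env_rel \<Gamma>1 e1 e1' \<Longrightarrow> env_rel \<Gamma>2 e2 e2' \<Longrightarrow> lrel \<sigma> (VClo P (e1 @ e2)) a \<Longrightarrow>
    lrel \<tau> (VClo (subst (length \<Gamma>1) P M) (e1 @ e2)) (VClo M (e1' @ a # e2'))"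
proof (induction "\<Gamma>1 @ \<sigma> # \<Gamma>2" M \<tau> arbitrary: \<Gamma>1 P e1 e1' rule: has_ty.induct)
  case (ty_Var i)
  show ?case
  proof (cases "i = length \<Gamma>1")
    case True
    have "lrel \<sigma> (VClo (Var i) (e1' @ a # e2')) (VClo P (e1 @ e2))"
      by (rule lrel_Tau[OF _ lrel_sym[OF ty_Var(5)]]) (use True ty_Var(3) in \<open>auto simp: env_rel_def nth_append\<close>)
    then show ?thesis using True by (auto intro: lrel_sym)
  next
    case False
    let ?i = "if i < length \<Gamma>1 then i else i - 1"
    have "lrel ((\<Gamma>1 @ \<sigma> # \<Gamma>2) ! i) ((e1 @ e2) ! ?i) ((e1' @ a # e2') ! i)"
      using ty_Var False by (auto simp: env_rel_def nth_append nth_Cons')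
    then show ?thesis by (rule lrel_Tau2[rotated 2]) (use False in auto)
  qed
next
  case (ty_Cn c)
  show ?case by (rule lrel_Tau2[OF _ _ lrel_cnst]) auto
next
  case (ty_Lam \<rho> M \<tau>)
  have "lrel \<tau> (VClo (subst (Suc (length \<Gamma>1)) (lift 0 P) M) (b # e1 @ e2)) (VClo M (b' # e1' @ a # e2'))"
    if b: "lrel \<rho> b b'" for b b'
  proof -
    have e: "env_rel (\<Gamma>1 @ \<Gamma>2) (e1 @ e2) (e1 @ e2)"
      using ty_Lam(4,5) env_rel_refl env_rel_append by blast
    have "lrel \<sigma> (VClo (lift 0 P) (b # e1 @ e2)) (VClo P (e1 @ e2))"
      using lrel_lift[of "[]" "\<Gamma>1 @ \<Gamma>2" P \<sigma> "[]" "[]" "e1 @ e2" "e1 @ e2" b] ty_Lam(3) e env_rel_Nil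
      by simp
    then have "lrel \<sigma> (VClo (lift 0 P) (b # e1 @ e2)) a" using ty_Lam(6) lrel_trans by blast
    then show ?thesis
      using ty_Lam(2)[of "\<rho> # \<Gamma>1" "lift 0 P" "b # e1" "b' # e1'"] ty_Lam(3,4,5) b
        has_ty_lift[of "[]" "\<Gamma>1 @ \<Gamma>2" P \<sigma> \<rho>]
      by (simp add: env_rel_Cons)
  qed
  then show ?case by (auto intro!: lrel_Lam)
next
  case (ty_App M \<rho> \<tau> P)
  then show ?case by (simp add: lrel_App[of \<rho>])
qed

lemma beta_eta_has_ty: "beta_eta \<Gamma> M M' \<tau> \<Longrightarrow> has_ty \<Gamma> M \<tau> \<and> has_ty \<Gamma> M' \<tau>"
proof (induction rule: beta_eta.induct)
  case (be_beta \<sigma> \<Gamma> M \<tau> P)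
  then show ?case using has_ty_subst[of "[]" \<sigma> \<Gamma>] by (auto intro: has_ty.intros)
next
  case (be_eta \<Gamma> M \<sigma> \<tau>)
  have "has_ty (\<sigma> # \<Gamma>) (Var 0) \<sigma>" using ty_Var[of 0 "\<sigma> # \<Gamma>"] by simp
  then show ?case using has_ty_lift[of "[]" \<Gamma> M _ \<sigma>] be_eta by (auto intro!: ty_Lam ty_App[of _ _ \<sigma>])
qed (auto intro: has_ty.intros)

text \<open>This justifies the passage to normal forms in the rules for recursion and minimisation.
  The eta case works because \<open>lrel\<close> observes functions only through
  application.\<close>

lemma beta_eta_lrel:
  "beta_eta \<Gamma> M M' \<tau> \<Longrightarrow> env_rel \<Gamma> e e' \<Longrightarrow> lrel \<tau> (VClo M e) (VClo M' e')"
proof (induction arbitrary: e e' rule: beta_eta.induct)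
  case (be_beta \<sigma> \<Gamma> M \<tau> P)
  have e: "env_rel \<Gamma> e' e" using be_beta(3) by (rule env_rel_sym)
  have "lrel \<tau> (VClo (subst 0 P M) e') (VClo M (VClo P e # e))"
    using lrel_subst[of "[]" \<sigma> \<Gamma> M \<tau> P "[]" "[]" e' e "VClo P e"] be_beta(1,2) e env_rel_Nil
      fundamental[OF be_beta(2) e] by simp
  then have "lrel \<tau> (VApp (VClo (Lam \<sigma> M) e) (VClo P e)) (VClo (subst 0 P M) e')"
    by (rule lrel_Tau[OF _ lrel_sym, rotated]) simp
  then show ?case by (rule lrel_Tau[rotated]) simp
next
  case (be_eta \<Gamma> M \<sigma> \<tau>)
  show ?case
  proof (rule lrel_funI)
    fix a b assume ab: "lrel \<sigma> a b"
    have 1: "lrel (\<sigma> \<^bold>\<rightarrow> \<tau>) (VClo (lift 0 M) (a # e)) (VClo M e')"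
      using lrel_lift[of "[]" \<Gamma> M _ "[]" "[]" e e' a] be_eta env_rel_Nil by simp
    have 2: "lrel \<sigma> (VClo (Var 0) (a # e)) b"
      using ab by (rule lrel_Tau[rotated]) simp
    have 3: "lrel \<tau> (VClo (lift 0 M \<^bold>\<cdot> Var 0) (a # e)) (VApp (VClo M e') b)"
      by (rule lrel_Tau[OF _ lrel_VApp[OF 1 2]]) simp
    show "lrel \<tau> (VApp (VClo (Lam \<sigma> (lift 0 M \<^bold>\<cdot> Var 0)) e) a) (VApp (VClo M e') b)"
      by (rule lrel_Tau[OF _ 3]) simp
  qed
next
  case (be_refl \<Gamma> M \<tau>)
  then show ?case by (rule fundamental)
next
  case (be_sym \<Gamma> M M' \<tau>)
  then show ?case using env_rel_sym lrel_sym by blast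
next
  case (be_trans \<Gamma> M M' \<tau> M'')
  then show ?case using env_rel_refl lrel_trans by blast
next
  case (be_App \<Gamma> M M' \<sigma> \<tau> P P')
  then show ?case by (blast intro: lrel_App)
next
  case (be_Lam \<sigma> \<Gamma> M M' \<tau>)
  then show ?case by (intro lrel_Lam) (auto simp: env_rel_Cons)
qed

section \<open>The interpretation agrees with the machine\<close>

lemma has_ty_unique: "has_ty \<Gamma> M \<sigma> \<Longrightarrow> has_ty \<Gamma> M \<tau> \<Longrightarrow> \<sigma> = \<tau>"
proof (induction arbitrary: \<tau> rule: has_ty.induct)
  case (ty_Lam \<sigma> \<Gamma> M \<rho>)
  then show ?case by (blast elim: has_ty_LamE)
next
  case (ty_App \<Gamma> M \<sigma> \<rho> P)
  then show ?case by (blast elim: has_ty_AppE)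
qed (auto elim: has_ty_VarE has_ty_CnE)

lemma app_list_Nil [simp]: "app_list H [] = H"
  and app_list_Cons [simp]: "app_list H (Y # Ys) = app_list (H \<^bold>\<cdot> Y) Ys"
  by (simp_all add: app_list_def)

lemma app_list_eq_Lam: "app_list H Ys = Lam \<sigma> M \<Longrightarrow> H = Lam \<sigma> M"
  by (induction Ys arbitrary: H) auto

lemma has_ty_app_list_cong:
  "has_ty \<Gamma> (app_list H Ys) \<tau> \<Longrightarrow> has_ty \<Gamma> H \<rho> \<Longrightarrow> has_ty \<Gamma> H' \<rho> \<Longrightarrow> has_ty \<Gamma> (app_list H' Ys) \<tau>"
proof (induction Ys arbitrary: H H' \<rho>)
  case Nil
  then show ?case using has_ty_unique by auto
next
  case (Cons Y Ys)
  have "\<exists>\<rho>'. has_ty \<Gamma> (H \<^bold>\<cdot> Y) \<rho>'"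
    using Cons.prems(1) by (induction Ys arbitrary: H Y) (fastforce elim: has_ty_AppE)+
  then obtain \<sigma> \<rho>' where H: "has_ty \<Gamma> H (\<sigma> \<^bold>\<rightarrow> \<rho>')" "has_ty \<Gamma> Y \<sigma>" by (auto elim: has_ty_AppE)
  then have "has_ty \<Gamma> H' (\<sigma> \<^bold>\<rightarrow> \<rho>')" using Cons.prems has_ty_unique by blast
  then show ?case
    using Cons.prems(1) H Cons.IH[of "H \<^bold>\<cdot> Y" \<rho>' "H' \<^bold>\<cdot> Y"] by (simp add: ty_App[of _ _ \<sigma>])
qed

lemma has_ty_app_list_head: "has_ty \<Gamma> (app_list H Ys) \<tau> \<Longrightarrow> \<exists>\<sigma>. has_ty \<Gamma> H \<sigma>"
  by (induction Ys arbitrary: H) (fastforce elim: has_ty_AppE)+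

lemma lrel_foldl:
  assumes "has_ty \<Gamma> (app_list H Ys) \<tau>" "has_ty \<Gamma> H \<sigma>" "lrel \<sigma> v u" "env_rel \<Gamma> e e'"
  shows "lrel \<tau> (foldl VApp v (map (\<lambda>Y. VClo Y e) Ys)) (foldl VApp u (map (\<lambda>Y. VClo Y e') Ys))"
  using assms(1-3)
proof (induction Ys arbitrary: H \<sigma> v u)
  case Nil
  then show ?case using has_ty_unique by auto
next
  case (Cons Y Ys)
  obtain \<rho> \<rho>' where H: "has_ty \<Gamma> H (\<rho> \<^bold>\<rightarrow> \<rho>')" "has_ty \<Gamma> Y \<rho>"
    using has_ty_app_list_head[of \<Gamma> "H \<^bold>\<cdot> Y" Ys \<tau>] Cons.prems(1) by (auto elim: has_ty_AppE)
  then have "lrel (\<rho> \<^bold>\<rightarrow> \<rho>') v u" using Cons.prems has_ty_unique by blast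
  then have "lrel \<rho>' (VApp v (VClo Y e)) (VApp u (VClo Y e'))"
    using fundamental[OF H(2) assms(4)] by (rule lrel_VApp)
  then show ?case
    using Cons.IH[of "H \<^bold>\<cdot> Y" \<rho>'] Cons.prems(1) H by (simp add: ty_App[of _ _ \<rho>])
qed

lemma step_foldl_Tau: "step v = Tau v' \<Longrightarrow> step (foldl VApp v as) = Tau (foldl VApp v' as)"
  by (induction as arbitrary: v v') (auto simp: step_VApp_Tau simp del: step.simps)

lemma step_foldl_Bind:
  "step v = Bind u k \<Longrightarrow> step (foldl VApp v as) = Bind u (\<lambda>n. foldl VApp (k n) as)"
  by (induction as arbitrary: v k) (auto simp: step_VApp_Bind simp del: step.simps)

lemma runs_app_list:
  "runs x w (VClo (app_list H Ys) e) m \<longleftrightarrow> runs x w (foldl VApp (VClo H e) (map (\<lambda>Y. VClo Y e) Ys)) m"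
proof (induction Ys arbitrary: H)
  case (Cons Y Ys)
  have "step (VClo (H \<^bold>\<cdot> Y) e) = Tau (VApp (VClo H e) (VClo Y e))" by simp
  then show ?case using Cons[of "H \<^bold>\<cdot> Y"] by (simp add: runs_Tau_iff[OF step_foldl_Tau])
qed simp

lemma lrel_VClo_App:
  "lrel (\<sigma> \<^bold>\<rightarrow> \<tau>) (VClo M e) v \<Longrightarrow> lrel \<sigma> (VClo P e) u \<Longrightarrow> lrel \<tau> (VClo (M \<^bold>\<cdot> P) e) (VApp v u)"
  by (rule lrel_Tau[OF _ lrel_VApp]) auto

lemma lrel_VClo_numeral: "lrel Nty (VClo (numeral_tm n) e) (VNum n)"
  by (rule lrel_Tau[OF _ lrel_VNum]) simp

lemma lrel_VClo_Cn: "lrel (cnst_ty c) (VClo (Cn c) e) (VC c)"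
  by (rule lrel_Tau[OF _ lrel_cnst]) simp

lemma runs_rec:
  "runs x w (foldl VApp (VClo (Cn (Rec \<sigma>) \<^bold>\<cdot> X \<^bold>\<cdot> F \<^bold>\<cdot> N) e) as) m \<longleftrightarrow>
    (\<exists>n. runs x w (VClo N e) n \<and> runs x w (foldl VApp (rec_val (VClo X e) (VClo F e) n) as) m)"
  by (simp add: runs_Tau_iff[OF step_foldl_Tau] runs_Bind_iff[OF step_foldl_Bind])

lemma runs_ifzero:
  "runs x w (VClo (Cn Ifzero \<^bold>\<cdot> M \<^bold>\<cdot> N \<^bold>\<cdot> P) e) m \<longleftrightarrow>
    (\<exists>n. runs x w (VClo M e) n \<and> runs x w (if n = 0 then VClo N e else VClo P e) m)"
  by (simp add: runs_Tau_iff runs_Bind_iff)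

lemma runs_min:
  "runs x w (VClo (Cn Min \<^bold>\<cdot> F \<^bold>\<cdot> N) e) m \<longleftrightarrow>
    (\<exists>n. runs x w (VClo N e) n \<and> runs x w (VMin (VClo F e) n) m)"
  by (simp add: runs_Tau_iff runs_Bind_iff del: step.simps(5))

text \<open>The interpretation reinserts recursion as a term at a numeral, while the machine
  continues with the unfolded value; the two agree.\<close>

lemma lrel_rec:
  assumes "lrel \<sigma> (VClo X e) (VClo X e)" "lrel (\<sigma> \<^bold>\<rightarrow> Nty \<^bold>\<rightarrow> \<sigma>) (VClo F e) (VClo F e)"
  shows "lrel \<sigma> (VClo (Cn (Rec \<sigma>) \<^bold>\<cdot> X \<^bold>\<cdot> F \<^bold>\<cdot> numeral_tm n) e) (rec_val (VClo X e) (VClo F e) n)"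
proof -
  have "lrel \<sigma> (VClo (Cn (Rec \<sigma>) \<^bold>\<cdot> X \<^bold>\<cdot> F \<^bold>\<cdot> numeral_tm n) e)
      (VApp (VApp (VApp (VC (Rec \<sigma>)) (VClo X e)) (VClo F e)) (VNum n))"
    by (rule lrel_VClo_App[OF lrel_VClo_App[OF lrel_VClo_App[OF
            lrel_VClo_Cn[of "Rec \<sigma>", simplified] assms(1)] assms(2)] lrel_VClo_numeral])
  moreover have "lrel \<sigma> (VApp (VApp (VApp (VC (Rec \<sigma>)) (VClo X e)) (VClo F e)) (VNum n))
      (rec_val (VClo X e) (VClo F e) n)"
    by (rule lrel_Bind_VNum[OF delta_step[OF delta.simps(5)] lrel_VNum])
      (intro lrel_rec_val[OF assms])+
  ultimately show ?thesis by (rule lrel_trans)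
qed

text \<open>A variable or constant of arrow type is not fully applied. An application of arrow type
  hands the flag \<open>False\<close> to its function part, which by induction is an abstraction,
  contradicting beta normality.\<close>

lemma long_nf_arrow:
  assumes "long_nf \<Gamma> M (\<sigma> \<^bold>\<rightarrow> \<tau>)"
  shows "\<exists>P. M = Lam \<sigma> P"
proof -
  have "has_ty \<Gamma> M (\<sigma> \<^bold>\<rightarrow> \<tau>) \<Longrightarrow> beta_normal M \<Longrightarrow> fully_applied False \<Gamma> M \<Longrightarrow> \<exists>P. M = Lam \<sigma> P"
  proof (induction M arbitrary: \<sigma> \<tau>)
    case (App M P)
    then obtain \<rho> where "has_ty \<Gamma> M (\<rho> \<^bold>\<rightarrow> \<sigma> \<^bold>\<rightarrow> \<tau>)" by (auto elim: has_ty_AppE)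
    moreover have "\<not> has_ty \<Gamma> (M \<^bold>\<cdot> P) Nty" using App.prems(1) has_ty_unique by blast
    ultimately show ?case using App by fastforce
  next
    case (Var i)
    then show ?case using has_ty_unique[of \<Gamma> "Var i" "\<sigma> \<^bold>\<rightarrow> \<tau>" Nty] by simp
  next
    case (Cn c)
    then show ?case using has_ty_unique[of \<Gamma> "Cn c" "\<sigma> \<^bold>\<rightarrow> \<tau>" Nty] by simp
  qed (auto elim: has_ty_LamE)
  then show ?thesis using assms by (simp add: long_nf_def)
qed

text \<open>The property inherited along the spine of a long normal form: a partial application is
  acceptable only with the flag supplied by its surroundings.\<close>

definition pre_nf :: "ty list \<Rightarrow> tm \<Rightarrow> bool" where
  "pre_nf \<Gamma> M \<longleftrightarrow> beta_normal M \<and> (\<exists>b. fully_applied b \<Gamma> M)"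

lemma pre_nf_App:
  "pre_nf \<Gamma> (M \<^bold>\<cdot> P) \<Longrightarrow> has_ty \<Gamma> (M \<^bold>\<cdot> P) \<tau> \<Longrightarrow>
    \<exists>\<sigma>. pre_nf \<Gamma> M \<and> has_ty \<Gamma> M (\<sigma> \<^bold>\<rightarrow> \<tau>) \<and> long_nf \<Gamma> P \<sigma>"
  by (auto simp: pre_nf_def long_nf_def elim!: has_ty_AppE)

lemma pre_nf_app_list: "pre_nf \<Gamma> (app_list H Ys) \<Longrightarrow> pre_nf \<Gamma> H"
proof (induction Ys arbitrary: H)
  case (Cons Y Ys)
  then have "pre_nf \<Gamma> (H \<^bold>\<cdot> Y)" by simp
  then show ?case by (auto simp: pre_nf_def)
qed simp

lemma long_nf_pre_nf: "long_nf \<Gamma> M \<tau> \<Longrightarrow> pre_nf \<Gamma> M \<and> has_ty \<Gamma> M \<tau>"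
  by (auto simp: long_nf_def pre_nf_def)

lemma (in extensional_tca) num_inj: "num A m = num A n \<longleftrightarrow> m = n"
  using num_bij by (auto simp: bij_betw_def inj_on_def)

text \<open>Lambda abstractions are only ever interpreted as arguments of the oracles, hence in contexts
  that extend the initial one by variables of type \<open>Nty\<close>.\<close>

locale oracle_model = T0_model A for A :: "'a type_structure" +
  fixes x :: "nat list" and w c :: nat and orc :: "bool \<Rightarrow> 'a"
  assumes orc: "represents A h g \<Longrightarrow> ap A (Nty \<^bold>\<rightarrow> Nty) Nty (orc b) h = num A (answer b x w g)"
begin

text \<open>The numbers \<open>ns\<close> are the values of the bound variables entered so far;
  behind them come the three arguments of the bar recursor.\<close>

definition ctx :: "nat list \<Rightarrow> ty list" where
  "ctx ns = map (\<lambda>_. Nty) ns @ [(Nty \<^bold>\<rightarrow> Nty) \<^bold>\<rightarrow> Nty, (Nty \<^bold>\<rightarrow> Nty) \<^bold>\<rightarrow> Nty, Nty]"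

definition vals :: "nat list \<Rightarrow> 'a list" where
  "vals ns = map (num A) ns @ [orc True, orc False, num A c]"

definition env :: "nat list \<Rightarrow> val list" where
  "env ns = map VNum ns @ [VOracle True, VOracle False, VNum c]"

lemma ctx_Cons: "ctx (n # ns) = Nty # ctx ns"
  and vals_Cons: "vals (n # ns) = num A n # vals ns"
  and env_Cons: "env (n # ns) = VNum n # env ns"
  by (simp_all add: ctx_def vals_def env_def)

lemma env_rel_env: "env_rel (ctx ns) (env ns) (env ns)"
proof (induction ns)
  case Nil
  show ?case by (auto simp: ctx_def env_def env_rel_Cons env_rel_Nil intro: lrel_VOracle lrel_VNum)
qed (simp add: ctx_Cons env_Cons env_rel_Cons lrel_VNum)

definition nat_sound :: "nat list \<Rightarrow> tm \<Rightarrow> 'a \<Rightarrow> bool" where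
  "nat_sound ns M a \<longleftrightarrow> (\<exists>m. a = num A m \<and> runs x w (VClo M (env ns)) m)"

definition fun_sound :: "nat list \<Rightarrow> tm \<Rightarrow> 'a \<Rightarrow> bool" where
  "fun_sound ns M a \<longleftrightarrow> (\<exists>g. represents A a g \<and> (\<forall>n. runs x w (VApp (VClo M (env ns)) (VNum n)) (g n)))"

text \<open>Two types suffice: functions are interpreted only as oracle arguments, and the arguments
  of recursion and minimisation with arrow types enter through normal forms. Typing and normality
  are premises because \<open>interp\<close> does not enforce them.\<close>

definition sound :: "nat list \<Rightarrow> tm \<Rightarrow> 'a \<Rightarrow> bool" where
  "sound ns M a \<longleftrightarrow> (long_nf (ctx ns) M Nty \<longrightarrow> nat_sound ns M a) \<and>
     (long_nf (ctx ns) M (Nty \<^bold>\<rightarrow> Nty) \<longrightarrow> fun_sound ns M a)"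

lemma nat_sound_num: "nat_sound ns M (num A m) \<longleftrightarrow> runs x w (VClo M (env ns)) m"
  by (auto simp: nat_sound_def num_inj)

lemma sound_num:
  "sound ns M (num A m) \<Longrightarrow> long_nf (ctx ns) M Nty \<Longrightarrow> runs x w (VClo M (env ns)) m"
  by (simp add: sound_def nat_sound_num)

lemma sound_natI:
  assumes "\<And>\<sigma> P. M \<noteq> Lam \<sigma> P"
    and "pre_nf (ctx ns) M \<Longrightarrow> has_ty (ctx ns) M Nty \<Longrightarrow> runs x w (VClo M (env ns)) m"
  shows "sound ns M (num A m)"
proof -
  have "\<not> long_nf (ctx ns) M (Nty \<^bold>\<rightarrow> Nty)" using assms(1) long_nf_arrow by blast
  then show ?thesis using assms(2) long_nf_pre_nf by (simp add: sound_def nat_sound_num)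
qed

lemma runs_nf_of:
  assumes "nf_of (ctx ns) M M'" "has_ty (ctx ns) M Nty" "sound ns M' (num A m)"
  shows "runs x w (VClo M (env ns)) m"
proof -
  obtain \<sigma> where nf: "long_nf (ctx ns) M' \<sigma>" "beta_eta (ctx ns) M M' \<sigma>"
    using assms(1) by (auto simp: nf_of_def)
  have "\<sigma> = Nty" using beta_eta_has_ty[OF nf(2)] assms(2) has_ty_unique by blast
  then show ?thesis
    using sound_num[OF assms(3)] nf lrel_NtyD(3)[OF beta_eta_lrel[OF _ env_rel_env]] by blast
qed

text \<open>Covers both recursion rules: \<open>H\<close> is \<open>X\<close> at zero and the
  unfolded step at a successor, with \<open>rec_val\<close> as its counterpart on the
  machine.\<close>

lemma sound_rec:
  assumes N: "sound ns N (num A n)"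
    and M: "nf_of (ctx ns) (app_list H Ys) M" "sound ns M (num A m)"
    and H: "has_ty (ctx ns) X \<sigma> \<Longrightarrow> has_ty (ctx ns) F (\<sigma> \<^bold>\<rightarrow> Nty \<^bold>\<rightarrow> \<sigma>) \<Longrightarrow> has_ty (ctx ns) H \<sigma> \<and>
        lrel \<sigma> (VClo H (env ns)) (rec_val (VClo X (env ns)) (VClo F (env ns)) n)"
  shows "sound ns (app_list (Cn (Rec \<sigma>) \<^bold>\<cdot> X \<^bold>\<cdot> F \<^bold>\<cdot> N) Ys) (num A m)"
proof (rule sound_natI)
  show "app_list (Cn (Rec \<sigma>) \<^bold>\<cdot> X \<^bold>\<cdot> F \<^bold>\<cdot> N) Ys \<noteq> Lam \<rho> P" for \<rho> P
    by (auto dest: app_list_eq_Lam)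
  let ?R = "Cn (Rec \<sigma>) \<^bold>\<cdot> X \<^bold>\<cdot> F \<^bold>\<cdot> N"
  let ?e = "env ns"
  assume pre: "pre_nf (ctx ns) (app_list ?R Ys)" and ty: "has_ty (ctx ns) (app_list ?R Ys) Nty"
  then obtain \<rho> where \<rho>: "has_ty (ctx ns) ?R \<rho>" using has_ty_app_list_head by blast
  then have R': "\<rho> = \<sigma>" "has_ty (ctx ns) X \<sigma>" "has_ty (ctx ns) F (\<sigma> \<^bold>\<rightarrow> Nty \<^bold>\<rightarrow> \<sigma>)"
      "has_ty (ctx ns) N Nty"
    by (auto elim!: has_ty_AppE has_ty_CnE)
  note R = \<rho>[unfolded R'(1)] R'(2-)
  have "long_nf (ctx ns) N Nty"
    using pre_nf_App[OF pre_nf_app_list[OF pre] R(1)] R(4) has_ty_unique by (auto simp: long_nf_def)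
  then have N': "runs x w (VClo N ?e) n" using N sound_num by blast
  note H' = H[OF R(2,3)]
  have H_ty: "has_ty (ctx ns) (app_list H Ys) Nty"
    using has_ty_app_list_cong[OF ty R(1)] H' by blast
  then have "runs x w (foldl VApp (VClo H ?e) (map (\<lambda>Y. VClo Y ?e) Ys)) m"
    using runs_nf_of[OF M(1) _ M(2)] runs_app_list by simp
  moreover have "lrel Nty (foldl VApp (VClo H ?e) (map (\<lambda>Y. VClo Y ?e) Ys))
      (foldl VApp (rec_val (VClo X ?e) (VClo F ?e) n) (map (\<lambda>Y. VClo Y ?e) Ys))"
    using lrel_foldl[OF H_ty _ _ env_rel_env] H' by blast
  ultimately have "runs x w (foldl VApp (rec_val (VClo X ?e) (VClo F ?e) n) (map (\<lambda>Y. VClo Y ?e) Ys)) m"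
    using lrel_NtyD(3) by blast
  then show "runs x w (VClo (app_list ?R Ys) ?e) m"
    unfolding runs_app_list runs_rec using N' by blast
qed

lemma min_types:
  assumes "pre_nf (ctx ns) (Cn Min \<^bold>\<cdot> F \<^bold>\<cdot> N)" "has_ty (ctx ns) (Cn Min \<^bold>\<cdot> F \<^bold>\<cdot> N) Nty"
  shows "has_ty (ctx ns) F (Nty \<^bold>\<rightarrow> Nty)" "long_nf (ctx ns) N Nty"
    "long_nf (ctx ns) (Cn Min \<^bold>\<cdot> F \<^bold>\<cdot> numeral_tm n) Nty"
proof -
  show F: "has_ty (ctx ns) F (Nty \<^bold>\<rightarrow> Nty)"
    using assms(2) by (auto elim!: has_ty_AppE has_ty_CnE)
  show "long_nf (ctx ns) N Nty"
    using assms by (auto simp: pre_nf_def long_nf_def elim!: has_ty_AppE has_ty_CnE)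
  have "has_ty (ctx ns) (Cn Min \<^bold>\<cdot> F \<^bold>\<cdot> numeral_tm n) Nty"
    using ty_App[OF ty_App[OF ty_Cn[of _ Min, simplified] F] ty_Cn[of _ "Numeral n", simplified]] .
  then show "long_nf (ctx ns) (Cn Min \<^bold>\<cdot> F \<^bold>\<cdot> numeral_tm n) Nty"
    using assms(1) ty_Cn[of "ctx ns" "Numeral n"] by (simp add: long_nf_def pre_nf_def)
qed

text \<open>Covers both minimisation rules. The continued search is itself in long normal form by
  \<open>min_types\<close>, so its soundness applies directly.\<close>

lemma sound_min:
  assumes N: "sound ns N (num A n)"
    and M: "nf_of (ctx ns) (F \<^bold>\<cdot> numeral_tm n) M" "sound ns M (num A i)"
    and m: "i = 0 \<and> m = n \<or> i \<noteq> 0 \<and> sound ns (Cn Min \<^bold>\<cdot> F \<^bold>\<cdot> numeral_tm (Suc n)) (num A m)"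
  shows "sound ns (Cn Min \<^bold>\<cdot> F \<^bold>\<cdot> N) (num A m)"
proof (rule sound_natI)
  let ?e = "env ns"
  assume pre: "pre_nf (ctx ns) (Cn Min \<^bold>\<cdot> F \<^bold>\<cdot> N)" "has_ty (ctx ns) (Cn Min \<^bold>\<cdot> F \<^bold>\<cdot> N) Nty"
  note F = min_types(1)[OF pre]
  have "has_ty (ctx ns) (F \<^bold>\<cdot> numeral_tm n) Nty"
    by (rule ty_App[OF F ty_Cn[of _ "Numeral n", simplified]])
  then have "runs x w (VClo (F \<^bold>\<cdot> numeral_tm n) ?e) i"
    using runs_nf_of[OF M(1) _ M(2)] by blast
  moreover have "lrel Nty (VClo (F \<^bold>\<cdot> numeral_tm n) ?e) (VApp (VClo F ?e) (VNum n))"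
    by (rule lrel_VClo_App[OF fundamental[OF F env_rel_env] lrel_VClo_numeral])
  ultimately have i: "runs x w (VApp (VClo F ?e) (VNum n)) i" using lrel_NtyD(3) by blast
  have "runs x w (if i = 0 then VNum n else VMin (VClo F ?e) (Suc n)) m"
  proof (cases "i = 0")
    case True
    then show ?thesis using m by (simp add: runs_Ret_iff)
  next
    case False
    then have "runs x w (VClo (Cn Min \<^bold>\<cdot> F \<^bold>\<cdot> numeral_tm (Suc n)) ?e) m"
      using m sound_num min_types(3)[OF pre] by blast
    then show ?thesis
      using False lrel_NtyD(3)[OF lrel_VClo_numeral] by (auto simp: runs_min runs_Ret_iff)
  qed
  with i have "runs x w (VMin (VClo F ?e) n) m" by (rule runs_Bind[OF step.simps(5)])
  then show "runs x w (VClo (Cn Min \<^bold>\<cdot> F \<^bold>\<cdot> N) ?e) m"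
    using sound_num[OF N min_types(2)[OF pre]] runs_min by blast
qed simp

lemma sound_oracle:
  assumes i: "ctx ns ! i = (Nty \<^bold>\<rightarrow> Nty) \<^bold>\<rightarrow> Nty" "i < length (ctx ns)"
    and Ps: "\<And>j. j < length Ps \<Longrightarrow> sound ns (Ps ! j) (as ! j)" "length as = length Ps"
    and ty: "pre_nf (ctx ns) (app_list (Var i) Ps)" "has_ty (ctx ns) (app_list (Var i) Ps) Nty"
  shows "nat_sound ns (app_list (Var i) Ps) (ap_list A (ctx ns ! i) (vals ns ! i) as)"
proof -
  obtain b where b: "vals ns ! i = orc b" "env ns ! i = VOracle b"
  proof -
    have "i = length ns \<or> i = Suc (length ns)"
      using i by (auto simp: ctx_def nth_append nth_Cons' split: if_splits)
    then show thesis using that[of True] that[of False]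
      by (auto simp: vals_def env_def nth_append)
  qed
  have Var: "has_ty (ctx ns) (Var i) ((Nty \<^bold>\<rightarrow> Nty) \<^bold>\<rightarrow> Nty)" using ty_Var[OF i(2)] i(1) by simp
  have "\<exists>P. Ps = [P]"
  proof (cases Ps)
    case Nil
    then show ?thesis using ty(2) has_ty_unique[OF Var] by auto
  next
    case (Cons P Qs)
    show ?thesis
    proof (cases Qs)
      case (Cons Q Qs')
      then obtain \<sigma> where "has_ty (ctx ns) (Var i \<^bold>\<cdot> P \<^bold>\<cdot> Q) \<sigma>"
        using has_ty_app_list_head[of _ "Var i \<^bold>\<cdot> P \<^bold>\<cdot> Q" Qs'] ty(2) \<open>Ps = P # Qs\<close> by auto
      then show ?thesis using has_ty_unique[OF Var] by (fastforce elim!: has_ty_AppE)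
    qed (use Cons in simp)
  qed
  then obtain P a where P: "Ps = [P]" "as = [a]"
    using Ps(2) by (cases as) auto
  have "long_nf (ctx ns) P (Nty \<^bold>\<rightarrow> Nty)"
    using pre_nf_App[of "ctx ns" "Var i" P Nty] ty has_ty_unique[OF Var] by (auto simp: P)
  then have "fun_sound ns P a" using Ps(1)[of 0] by (simp add: P sound_def)
  then obtain g where g: "represents A a g" "\<And>n. runs x w (VApp (VClo P (env ns)) (VNum n)) (g n)"
    by (auto simp: fun_sound_def)
  have "runs x w (VApp (VOracle b) (VClo P (env ns))) (answer b x w g)"
    using g(2) by (intro runs_Ask) auto
  then have "runs x w (VClo (Var i \<^bold>\<cdot> P) (env ns)) (answer b x w g)"
    by (simp add: runs_Tau_iff b)
  then show ?thesis using orc[OF g(1)] by (simp add: P i(1) b nat_sound_def num_inj)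
qed

text \<open>Only an implication can be expected: the machine evaluates oracle arguments at queried
  positions only and may therefore terminate more often.\<close>

lemma interp_sound: "interp A \<Gamma> \<nu> M a \<Longrightarrow> \<Gamma> = ctx ns \<Longrightarrow> \<nu> = vals ns \<Longrightarrow> sound ns M a"
proof (induction arbitrary: ns rule: interp.induct)
  case (i_numeral \<Gamma> \<nu> n)
  show ?case by (rule sound_natI) (simp_all add: runs_Tau_iff runs_Ret_iff)
next
  case (i_suc \<Gamma> \<nu> M n)
  show ?case
  proof (rule sound_natI)
    assume "pre_nf (ctx ns) (Cn Succ \<^bold>\<cdot> M)" "has_ty (ctx ns) (Cn Succ \<^bold>\<cdot> M) Nty"
    then have "long_nf (ctx ns) M Nty"
      by (auto simp: pre_nf_def long_nf_def elim!: has_ty_AppE has_ty_CnE)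
    then have "runs x w (VClo M (env ns)) n" using i_suc sound_num by blast
    then show "runs x w (VClo (Cn Succ \<^bold>\<cdot> M) (env ns)) (n + 1)"
      by (auto simp: runs_Tau_iff runs_Bind_iff runs_Ret_iff)
  qed simp
next
  case (i_pre \<Gamma> \<nu> M n)
  show ?case
  proof (rule sound_natI)
    assume "pre_nf (ctx ns) (Cn Pred \<^bold>\<cdot> M)" "has_ty (ctx ns) (Cn Pred \<^bold>\<cdot> M) Nty"
    then have "long_nf (ctx ns) M Nty"
      by (auto simp: pre_nf_def long_nf_def elim!: has_ty_AppE has_ty_CnE)
    then have "runs x w (VClo M (env ns)) n" using i_pre sound_num by blast
    then show "runs x w (VClo (Cn Pred \<^bold>\<cdot> M) (env ns)) (n - 1)"
      by (auto simp: runs_Tau_iff runs_Bind_iff runs_Ret_iff)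
  qed simp
next
  case (i_ifzero_0 \<Gamma> \<nu> M N n P)
  show ?case
  proof (rule sound_natI)
    assume "pre_nf (ctx ns) (Cn Ifzero \<^bold>\<cdot> M \<^bold>\<cdot> N \<^bold>\<cdot> P)" "has_ty (ctx ns) (Cn Ifzero \<^bold>\<cdot> M \<^bold>\<cdot> N \<^bold>\<cdot> P) Nty"
    then have "long_nf (ctx ns) M Nty" "long_nf (ctx ns) N Nty"
      by (auto simp: pre_nf_def long_nf_def elim!: has_ty_AppE has_ty_CnE)
    then have "runs x w (VClo M (env ns)) 0" "runs x w (VClo N (env ns)) n"
      using i_ifzero_0 sound_num by blast+
    then show "runs x w (VClo (Cn Ifzero \<^bold>\<cdot> M \<^bold>\<cdot> N \<^bold>\<cdot> P) (env ns)) n"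
      unfolding runs_ifzero by (intro exI[of _ 0]) simp
  qed simp
next
  case (i_ifzero_Suc \<Gamma> \<nu> M k P n N)
  show ?case
  proof (rule sound_natI)
    assume "pre_nf (ctx ns) (Cn Ifzero \<^bold>\<cdot> M \<^bold>\<cdot> N \<^bold>\<cdot> P)" "has_ty (ctx ns) (Cn Ifzero \<^bold>\<cdot> M \<^bold>\<cdot> N \<^bold>\<cdot> P) Nty"
    then have "long_nf (ctx ns) M Nty" "long_nf (ctx ns) P Nty"
      by (auto simp: pre_nf_def long_nf_def elim!: has_ty_AppE has_ty_CnE)
    then have "runs x w (VClo M (env ns)) (k + 1)" "runs x w (VClo P (env ns)) n"
      using i_ifzero_Suc sound_num by blast+
    then show "runs x w (VClo (Cn Ifzero \<^bold>\<cdot> M \<^bold>\<cdot> N \<^bold>\<cdot> P) (env ns)) n"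
      unfolding runs_ifzero by (intro exI[of _ "k + 1"]) simp
  qed simp
next
  case (i_rec_0 \<Gamma> \<nu> N X Ys M m \<sigma> F)
  show ?case
    by (rule sound_rec[of ns N 0 X Ys M])
      (use i_rec_0 in \<open>auto intro: fundamental[OF _ env_rel_env]\<close>)
next
  case (i_rec_Suc \<Gamma> \<nu> N n F \<sigma> X Ys M m)
  let ?H = "F \<^bold>\<cdot> (Cn (Rec \<sigma>) \<^bold>\<cdot> X \<^bold>\<cdot> F \<^bold>\<cdot> numeral_tm n) \<^bold>\<cdot> numeral_tm n"
  show ?case
  proof (rule sound_rec[of ns N "Suc n" ?H Ys M])
    assume X: "has_ty (ctx ns) X \<sigma>" and F: "has_ty (ctx ns) F (\<sigma> \<^bold>\<rightarrow> Nty \<^bold>\<rightarrow> \<sigma>)"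
    have num: "has_ty (ctx ns) (numeral_tm n) Nty" using ty_Cn[of _ "Numeral n"] by simp
    have "has_ty (ctx ns) (Cn (Rec \<sigma>) \<^bold>\<cdot> X \<^bold>\<cdot> F \<^bold>\<cdot> numeral_tm n) \<sigma>"
      using ty_App[OF ty_App[OF ty_App[OF ty_Cn[of _ "Rec \<sigma>", simplified] X] F] num] .
    then have "has_ty (ctx ns) ?H \<sigma>" using ty_App[OF ty_App[OF F] num] by blast
    moreover have "lrel \<sigma> (VClo ?H (env ns)) (rec_val (VClo X (env ns)) (VClo F (env ns)) (Suc n))"
      unfolding rec_val.simps
      by (rule lrel_VClo_App[OF lrel_VClo_App[OF _ lrel_rec] lrel_VClo_numeral])
        (rule fundamental[OF F env_rel_env] fundamental[OF X env_rel_env])+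
    ultimately show "has_ty (ctx ns) ?H \<sigma> \<and>
        lrel \<sigma> (VClo ?H (env ns)) (rec_val (VClo X (env ns)) (VClo F (env ns)) (Suc n))" ..
  qed (use i_rec_Suc in auto)
next
  case (i_min_0 \<Gamma> \<nu> N n F M)
  show ?case by (rule sound_min[of ns N n F M 0]) (use i_min_0 in auto)
next
  case (i_min_Suc \<Gamma> \<nu> N n F M i m)
  show ?case by (rule sound_min[of ns N n F M "Suc i"]) (use i_min_Suc in auto)
next
  case (i_lam \<sigma> \<Gamma> M \<tau> f \<nu>)
  have "fun_sound ns (Lam \<sigma> M) f" if nf: "long_nf (ctx ns) (Lam \<sigma> M) (Nty \<^bold>\<rightarrow> Nty)"
  proof -
    have [simp]: "\<sigma> = Nty" "\<tau> = Nty"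
      using nf i_lam.hyps(1) i_lam.prems(1) has_ty_unique
      by (auto simp: long_nf_def elim!: has_ty_LamE)
    have "nat_sound (n # ns) M (ap A Nty Nty f (num A n))" for n
    proof -
      have "long_nf (ctx (n # ns)) M Nty"
        using nf by (auto simp: long_nf_def ctx_Cons elim!: has_ty_LamE)
      moreover have "num A n \<in> car A \<sigma>" using num_bij by (auto simp: bij_betw_def)
      then have "sound (n # ns) M (ap A \<sigma> \<tau> f (num A n))"
        by (rule i_lam.IH) (use i_lam.prems in \<open>simp_all add: ctx_Cons vals_Cons\<close>)
      ultimately show ?thesis by (simp add: sound_def)
    qed
    then obtain g where g: "\<And>n. ap A Nty Nty f (num A n) = num A (g n)"
        "\<And>n. runs x w (VClo M (VNum n # env ns)) (g n)"
      unfolding nat_sound_def env_Cons by metis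
    then show ?thesis
      using i_lam.hyps(2) by (auto simp: fun_sound_def represents_def runs_Tau_iff intro!: exI[of _ g])
  qed
  moreover have "\<not> long_nf (ctx ns) (Lam \<sigma> M) Nty"
    by (auto simp: long_nf_def elim: has_ty_LamE)
  ultimately show ?case by (simp add: sound_def)
next
  case (i_var i \<Gamma> \<nu> f as Ps)
  have "nat_sound ns (app_list (Var i) Ps) (ap_list A (\<Gamma> ! i) f as)"
    if nf: "long_nf (ctx ns) (app_list (Var i) Ps) Nty"
  proof (cases "\<Gamma> ! i = Nty")
    case True
    have Var: "has_ty (ctx ns) (Var i) Nty" using ty_Var i_var True by metis
    have "Ps = []"
    proof (cases Ps)
      case (Cons P Qs)
      then obtain \<sigma> where "has_ty (ctx ns) (Var i \<^bold>\<cdot> P) \<sigma>"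
        using nf has_ty_app_list_head[of "ctx ns" "Var i \<^bold>\<cdot> P" Qs Nty] Cons by (auto simp: long_nf_def)
      then show ?thesis using has_ty_unique[OF Var] by (auto elim!: has_ty_AppE)
    qed
    moreover obtain n where "vals ns ! i = num A n" "env ns ! i = VNum n"
    proof -
      have "i < length ns \<or> i = length ns + 2"
        using i_var True by (auto simp: ctx_def nth_append nth_Cons' split: if_splits)
      then show thesis using that by (auto simp: vals_def env_def nth_append)
    qed
    ultimately show ?thesis
      using i_var by (auto simp: nat_sound_def num_inj runs_Tau_iff runs_Ret_iff)
  next
    case False
    then have "ctx ns ! i = (Nty \<^bold>\<rightarrow> Nty) \<^bold>\<rightarrow> Nty"
      using i_var.hyps(1) i_var.prems(1) by (auto simp: ctx_def nth_append nth_Cons' split: if_splits)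
    then show ?thesis
      using i_var.hyps i_var.prems i_var.IH sound_oracle[of ns i Ps as] long_nf_pre_nf[OF nf]
      by simp
  qed
  moreover have "\<not> long_nf (ctx ns) (app_list (Var i) Ps) (Nty \<^bold>\<rightarrow> Nty)"
    using long_nf_arrow app_list_eq_Lam by blast
  ultimately show ?case by (simp add: sound_def)
qed

end

section \<open>The adversary's oracles are present in the model\<close>

context T0_model
begin

lemma num_in_car: "num A n \<in> car A Nty"
  using num_bij by (auto simp: bij_betw_def)

lemma ex_const:
  assumes "a \<in> car A \<sigma>"
  shows "\<exists>f\<in>car A (\<rho> \<^bold>\<rightarrow> \<sigma>). \<forall>z\<in>car A \<rho>. ap A \<rho> \<sigma> f z = a"
proof -
  obtain k where "k \<in> car A (\<sigma> \<^bold>\<rightarrow> \<rho> \<^bold>\<rightarrow> \<sigma>)"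
    "\<forall>x\<in>car A \<sigma>. \<forall>y\<in>car A \<rho>. ap A \<rho> \<sigma> (ap A \<sigma> (\<rho> \<^bold>\<rightarrow> \<sigma>) k x) y = x"
    using ex_k by blast
  then show ?thesis using assms ap_closed by blast
qed

lemma ex_app:
  assumes "f \<in> car A (\<rho> \<^bold>\<rightarrow> \<sigma> \<^bold>\<rightarrow> \<tau>)" "g \<in> car A (\<rho> \<^bold>\<rightarrow> \<sigma>)"
  shows "\<exists>h\<in>car A (\<rho> \<^bold>\<rightarrow> \<tau>). \<forall>z\<in>car A \<rho>.
    ap A \<rho> \<tau> h z = ap A \<sigma> \<tau> (ap A \<rho> (\<sigma> \<^bold>\<rightarrow> \<tau>) f z) (ap A \<rho> \<sigma> g z)"
proof -
  obtain s where s: "s \<in> car A ((\<rho> \<^bold>\<rightarrow> \<sigma> \<^bold>\<rightarrow> \<tau>) \<^bold>\<rightarrow> (\<rho> \<^bold>\<rightarrow> \<sigma>) \<^bold>\<rightarrow> \<rho> \<^bold>\<rightarrow> \<tau>)"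
    and eq: "\<forall>x \<in> car A (\<rho> \<^bold>\<rightarrow> \<sigma> \<^bold>\<rightarrow> \<tau>). \<forall>y \<in> car A (\<rho> \<^bold>\<rightarrow> \<sigma>). \<forall>z \<in> car A \<rho>.
            ap A \<rho> \<tau> (ap A (\<rho> \<^bold>\<rightarrow> \<sigma>) (\<rho> \<^bold>\<rightarrow> \<tau>)
                (ap A (\<rho> \<^bold>\<rightarrow> \<sigma> \<^bold>\<rightarrow> \<tau>) ((\<rho> \<^bold>\<rightarrow> \<sigma>) \<^bold>\<rightarrow> \<rho> \<^bold>\<rightarrow> \<tau>) s x) y) z
            = ap A \<sigma> \<tau> (ap A \<rho> (\<sigma> \<^bold>\<rightarrow> \<tau>) x z) (ap A \<rho> \<sigma> y z)"
    using ex_s by blast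
  have "ap A (\<rho> \<^bold>\<rightarrow> \<sigma>) (\<rho> \<^bold>\<rightarrow> \<tau>) (ap A (\<rho> \<^bold>\<rightarrow> \<sigma> \<^bold>\<rightarrow> \<tau>) ((\<rho> \<^bold>\<rightarrow> \<sigma>) \<^bold>\<rightarrow> \<rho> \<^bold>\<rightarrow> \<tau>) s f) g \<in> car A (\<rho> \<^bold>\<rightarrow> \<tau>)"
    by (rule ap_closed[OF ap_closed[OF s assms(1)] assms(2)])
  then show ?thesis using eq assms by blast
qed

lemma ex_id: "\<exists>f\<in>car A (\<sigma> \<^bold>\<rightarrow> \<sigma>). \<forall>z\<in>car A \<sigma>. ap A \<sigma> \<sigma> f z = z"
proof -
  obtain k where k: "k \<in> car A (\<sigma> \<^bold>\<rightarrow> (\<sigma> \<^bold>\<rightarrow> \<sigma>) \<^bold>\<rightarrow> \<sigma>)"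
    "\<forall>x\<in>car A \<sigma>. \<forall>y\<in>car A (\<sigma> \<^bold>\<rightarrow> \<sigma>). ap A (\<sigma> \<^bold>\<rightarrow> \<sigma>) \<sigma> (ap A \<sigma> ((\<sigma> \<^bold>\<rightarrow> \<sigma>) \<^bold>\<rightarrow> \<sigma>) k x) y = x"
    using ex_k by blast
  obtain k' where k': "k' \<in> car A (\<sigma> \<^bold>\<rightarrow> \<sigma> \<^bold>\<rightarrow> \<sigma>)" using ex_k by blast
  show ?thesis using ex_app[OF k(1) k'] k ap_closed[OF k'] by metis
qed

text \<open>Only represented functions are tested, since the model may lack other functions on the
  numbers.\<close>

definition functional :: "((nat \<Rightarrow> nat) \<Rightarrow> nat) \<Rightarrow> bool" where
  "functional \<Phi> \<longleftrightarrow> (\<exists>F\<in>car A ((Nty \<^bold>\<rightarrow> Nty) \<^bold>\<rightarrow> Nty).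
     \<forall>h g. represents A h g \<longrightarrow> ap A (Nty \<^bold>\<rightarrow> Nty) Nty F h = num A (\<Phi> g))"

lemma represents_car: "represents A h g \<Longrightarrow> h \<in> car A (Nty \<^bold>\<rightarrow> Nty)"
  by (simp add: represents_def)

lemma functional_const: "functional (\<lambda>_. c)"
  using ex_const[OF num_in_car[of c]] represents_car unfolding functional_def by blast

lemma functional_apply: "functional (\<lambda>g. g c)"
proof -
  obtain i where i: "i \<in> car A ((Nty \<^bold>\<rightarrow> Nty) \<^bold>\<rightarrow> (Nty \<^bold>\<rightarrow> Nty))"
    "\<forall>z\<in>car A (Nty \<^bold>\<rightarrow> Nty). ap A (Nty \<^bold>\<rightarrow> Nty) (Nty \<^bold>\<rightarrow> Nty) i z = z"
    using ex_id by blast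
  obtain k where k: "k \<in> car A ((Nty \<^bold>\<rightarrow> Nty) \<^bold>\<rightarrow> Nty)"
    "\<forall>z\<in>car A (Nty \<^bold>\<rightarrow> Nty). ap A (Nty \<^bold>\<rightarrow> Nty) Nty k z = num A c"
    using ex_const[OF num_in_car] by blast
  obtain F where F: "F \<in> car A ((Nty \<^bold>\<rightarrow> Nty) \<^bold>\<rightarrow> Nty)"
    "\<forall>z\<in>car A (Nty \<^bold>\<rightarrow> Nty). ap A (Nty \<^bold>\<rightarrow> Nty) Nty F z = ap A Nty Nty z (num A c)"
    using ex_app[OF i(1) k(1)] i(2) k(2) by auto
  then show ?thesis
    unfolding functional_def by (intro bexI[of _ F]) (auto simp: represents_def)
qed

lemma functional_comp:
  assumes "represents A u \<phi>" "functional \<Phi>"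
  shows "functional (\<lambda>g. \<phi> (\<Phi> g))"
proof -
  obtain k where k: "k \<in> car A ((Nty \<^bold>\<rightarrow> Nty) \<^bold>\<rightarrow> Nty \<^bold>\<rightarrow> Nty)"
    "\<forall>z\<in>car A (Nty \<^bold>\<rightarrow> Nty). ap A (Nty \<^bold>\<rightarrow> Nty) (Nty \<^bold>\<rightarrow> Nty) k z = u"
    using ex_const represents_car[OF assms(1)] by blast
  obtain F where F: "F \<in> car A ((Nty \<^bold>\<rightarrow> Nty) \<^bold>\<rightarrow> Nty)"
    "\<forall>h g. represents A h g \<longrightarrow> ap A (Nty \<^bold>\<rightarrow> Nty) Nty F h = num A (\<Phi> g)"
    using assms(2) by (auto simp: functional_def)
  obtain H where H: "H \<in> car A ((Nty \<^bold>\<rightarrow> Nty) \<^bold>\<rightarrow> Nty)"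
    "\<forall>z\<in>car A (Nty \<^bold>\<rightarrow> Nty). ap A (Nty \<^bold>\<rightarrow> Nty) Nty H z = ap A Nty Nty u (ap A (Nty \<^bold>\<rightarrow> Nty) Nty F z)"
    using ex_app[OF k(1) F(1)] k(2) by auto
  have "ap A (Nty \<^bold>\<rightarrow> Nty) Nty H h = num A (\<phi> (\<Phi> g))" if "represents A h g" for h g
    using that F(2) H(2) represents_car[OF that] assms(1)[unfolded represents_def] by simp
  then show ?thesis using H(1) unfolding functional_def by blast
qed

lemma functional_ifzero:
  assumes "functional \<Phi>" "functional \<Phi>1" "functional \<Phi>2"
  shows "functional (\<lambda>g. if \<Phi> g = 0 then \<Phi>1 g else \<Phi>2 g)"
proof -
  let ?NN = "Nty \<^bold>\<rightarrow> Nty"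
  obtain c where c: "c \<in> car A (Nty \<^bold>\<rightarrow> Nty \<^bold>\<rightarrow> ?NN)"
    and c0: "\<And>x y. x \<in> car A Nty \<Longrightarrow> y \<in> car A Nty \<Longrightarrow>
      ap A Nty Nty (ap A Nty ?NN (ap A Nty (Nty \<^bold>\<rightarrow> ?NN) c (num A 0)) x) y = x"
    and c1: "\<And>n x y. x \<in> car A Nty \<Longrightarrow> y \<in> car A Nty \<Longrightarrow>
      ap A Nty Nty (ap A Nty ?NN (ap A Nty (Nty \<^bold>\<rightarrow> ?NN) c (num A (Suc n))) x) y = y"
    using ex_ifzero by auto
  obtain k where k: "k \<in> car A (?NN \<^bold>\<rightarrow> Nty \<^bold>\<rightarrow> Nty \<^bold>\<rightarrow> ?NN)"
    "\<forall>z\<in>car A ?NN. ap A ?NN (Nty \<^bold>\<rightarrow> Nty \<^bold>\<rightarrow> ?NN) k z = c"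
    using ex_const[OF c] by blast
  obtain F where F: "F \<in> car A (?NN \<^bold>\<rightarrow> Nty)"
    "\<forall>h g. represents A h g \<longrightarrow> ap A ?NN Nty F h = num A (\<Phi> g)"
    using assms(1) by (auto simp: functional_def)
  obtain F1 where F1: "F1 \<in> car A (?NN \<^bold>\<rightarrow> Nty)"
    "\<forall>h g. represents A h g \<longrightarrow> ap A ?NN Nty F1 h = num A (\<Phi>1 g)"
    using assms(2) by (auto simp: functional_def)
  obtain F2 where F2: "F2 \<in> car A (?NN \<^bold>\<rightarrow> Nty)"
    "\<forall>h g. represents A h g \<longrightarrow> ap A ?NN Nty F2 h = num A (\<Phi>2 g)"
    using assms(3) by (auto simp: functional_def)
  obtain H where H: "H \<in> car A (?NN \<^bold>\<rightarrow> Nty \<^bold>\<rightarrow> ?NN)"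
    "\<forall>z\<in>car A ?NN. ap A ?NN (Nty \<^bold>\<rightarrow> ?NN) H z = ap A Nty (Nty \<^bold>\<rightarrow> ?NN) c (ap A ?NN Nty F z)"
    using ex_app[OF k(1) F(1)] k(2) by auto
  obtain H1 where H1: "H1 \<in> car A (?NN \<^bold>\<rightarrow> ?NN)"
    "\<forall>z\<in>car A ?NN. ap A ?NN ?NN H1 z = ap A Nty ?NN (ap A ?NN (Nty \<^bold>\<rightarrow> ?NN) H z) (ap A ?NN Nty F1 z)"
    using ex_app[OF H(1) F1(1)] by blast
  obtain H2 where H2: "H2 \<in> car A (?NN \<^bold>\<rightarrow> Nty)"
    "\<forall>z\<in>car A ?NN. ap A ?NN Nty H2 z = ap A Nty Nty (ap A ?NN ?NN H1 z) (ap A ?NN Nty F2 z)"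
    using ex_app[OF H1(1) F2(1)] by blast
  have "ap A ?NN Nty H2 h = num A (if \<Phi> g = 0 then \<Phi>1 g else \<Phi>2 g)" if "represents A h g" for h g
    using that represents_car[OF that] F(2) F1(2) F2(2) H(2) H1(2) H2(2) c0 c1 num_in_car
    by (cases "\<Phi> g") auto
  then show ?thesis using H2(1) unfolding functional_def by blast
qed

lemma functional_if_eq:
  assumes "functional \<Phi>" "functional \<Phi>1" "functional \<Phi>2"
  shows "functional (\<lambda>g. if \<Phi> g = c then \<Phi>1 g else \<Phi>2 g)"
proof -
  \<comment> \<open>This sequence vanishes exactly at \<open>c\<close> and is eventually constant,
    hence present in the model; it turns a test for \<open>c\<close> into a test for 0.\<close>
  let ?d = "padded (replicate c 1 @ [0]) 1"
  have d: "?d i = 0 \<longleftrightarrow> i = c" for i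
    by (auto simp: padded_def nth_append)
  have "functional (\<lambda>g. if ?d (\<Phi> g) = 0 then \<Phi>1 g else \<Phi>2 g)"
    by (intro functional_ifzero functional_comp[OF represents_padded_elem] assms)
  then show ?thesis by (simp only: d)
qed

lemma functional_exit_value: "functional (exit_value x k)"
proof (induction x arbitrary: k)
  case Nil
  show ?case using functional_apply by simp
next
  case (Cons a x)
  show ?case using functional_if_eq[OF functional_apply Cons functional_apply] by simp
qed

lemma functional_hit:
  assumes "functional \<Phi>1" "functional \<Phi>2"
  shows "functional (\<lambda>g. if hit x w g i then \<Phi>1 g else \<Phi>2 g)"
proof -
  let ?c = "2 * list_encode (take i x @ [0]) + 1"
  have "functional (\<lambda>g. if g (x ! i) = w then \<Phi>1 g else \<Phi>2 g)"
    by (intro functional_if_eq functional_apply assms)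
  then have "functional (\<lambda>g. if i < length x \<longrightarrow> g (x ! i) = w then \<Phi>1 g else \<Phi>2 g)"
    using assms(1) by (cases "i < length x") auto
  then have "functional (\<lambda>g. if g 0 = ?c then
      if i < length x \<longrightarrow> g (x ! i) = w then \<Phi>1 g else \<Phi>2 g else \<Phi>2 g)"
    by (intro functional_if_eq functional_apply assms)
  moreover have "(\<lambda>g. if hit x w g i then \<Phi>1 g else \<Phi>2 g) = (\<lambda>g. if g 0 = ?c then
      if i < length x \<longrightarrow> g (x ! i) = w then \<Phi>1 g else \<Phi>2 g else \<Phi>2 g)"
    by (auto simp: hit_def)
  ultimately show ?thesis by simp
qed

text \<open>For fixed \<open>x\<close> and \<open>w\<close> the oracles are case distinctions on
  finitely many values of \<open>g\<close>, so nested conditionals realise them.\<close>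

lemma functional_answer: "functional (answer b x w)"
proof (cases b)
  case True
  then show ?thesis using functional_exit_value by (simp add: answer_def[abs_def])
next
  case False
  have "functional (\<lambda>g. if \<exists>i<n. hit x w g i then w else 0)" for n
  proof (induction n)
    case 0
    show ?case using functional_const by simp
  next
    case (Suc n)
    have "(\<lambda>g. if \<exists>i<Suc n. hit x w g i then w else 0) =
        (\<lambda>g. if hit x w g n then w else if \<exists>i<n. hit x w g i then w else 0)"
      by (intro ext) (auto simp: less_Suc_eq)
    then show ?case using functional_hit[OF functional_const Suc] by simp
  qed
  from this[of "Suc (length x)"] show ?thesis
    using False by (simp add: answer_def[abs_def] less_Suc_eq_le)
qed

section \<open>The bar recursor on the adversary's oracles\<close>

lemma exit_value_padded_take:
  assumes x: "path x" and "i \<le> length x" "j < 2"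
  shows "exit_value x 0 (padded (take i x) j) = j"
proof -
  have "exit_value x 0 (padded (take i x) j) = padded (take i x) j (0 + i)"
  proof (rule exit_value_eq[OF assms(2)])
    show "i = length x \<or> padded (take i x) j (0 + i) \<noteq> x ! i"
    proof (cases "i < length x")
      case True
      then have "2 \<le> x ! i" using x by (simp add: path_def)
      then show ?thesis using assms(3) by (simp add: padded_def)
    qed (use assms(2) in simp)
  qed (use assms(2) in \<open>auto simp: padded_def\<close>)
  then show ?thesis using assms(2) by (simp add: padded_def)
qed

text \<open>Off the path the value does not depend on the padding \<open>j\<close>, which is the
  stopping condition of the tree.\<close>

lemma exit_value_padded_leave:
  assumes "i \<le> length x" "i = length x \<or> z \<noteq> x ! i"
  shows "exit_value x 0 (padded (take i x @ [z]) j) = z"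
proof -
  have "exit_value x 0 (padded (take i x @ [z]) j) = padded (take i x @ [z]) j (0 + i)"
    by (rule exit_value_eq[OF assms(1)]) (use assms in \<open>auto simp: padded_def nth_append\<close>)
  then show ?thesis using assms(1) by (simp add: padded_def nth_append)
qed

context
  fixes x F
  assumes x: "path x"
    and F: "\<And>h g. represents A h g \<Longrightarrow> ap A (Nty \<^bold>\<rightarrow> Nty) Nty F h = num A (exit_value x 0 g)"
begin

lemma kohlenbach_tree_iff: "xs \<in> kohlenbach_tree A F \<longleftrightarrow>
    (\<forall>ys. strict_prefix ys xs \<longrightarrow> exit_value x 0 (padded ys 0) \<noteq> exit_value x 0 (padded ys 1))"
  by (auto simp: kohlenbach_tree_def F[OF represents_padded_elem] num_inj)

text \<open>Proper prefixes lie on \<open>x\<close>, where \<open>F\<close> returns the padding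
  itself and so separates 0 from 1.\<close>

lemma snoc_in_tree:
  assumes "i \<le> length x"
  shows "take i x @ [z] \<in> kohlenbach_tree A F"
  unfolding kohlenbach_tree_iff
proof (intro allI impI)
  fix ys assume "strict_prefix ys (take i x @ [z])"
  then have "prefix ys (take i x)" by (auto simp: strict_prefix_def)
  then have "prefix ys x" using take_is_prefix by (rule prefix_order.trans)
  then have "ys = take (length ys) x" "length ys \<le> length x" by (auto simp: prefix_def)
  then have "exit_value x 0 (padded ys j) = j" if "j < 2" for j
    using exit_value_padded_take[OF x _ that] by metis
  then show "exit_value x 0 (padded ys 0) \<noteq> exit_value x 0 (padded ys 1)" by simp
qed

lemma leave_not_in_tree:
  assumes "i \<le> length x" "i = length x \<or> z \<noteq> x ! i"
  shows "take i x @ [z, y] \<notin> kohlenbach_tree A F"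
proof -
  have "strict_prefix (take i x @ [z]) (take i x @ [z, y])"
    by (simp add: strict_prefix_def prefix_def)
  then show ?thesis
    unfolding kohlenbach_tree_iff using exit_value_padded_leave[OF assms] by metis
qed

lemma take_internal:
  assumes "i \<le> length x"
  shows "take i x \<in> internal_nodes (kohlenbach_tree A F)"
proof -
  have "strict_prefix ys (take i x) \<Longrightarrow> strict_prefix ys (take i x @ [0])" for ys
    by (auto simp: strict_prefix_def prefix_def)
  then have "take i x \<in> kohlenbach_tree A F"
    using snoc_in_tree[OF assms, of 0] unfolding kohlenbach_tree_iff by blast
  then show ?thesis using snoc_in_tree[OF assms] by (auto simp: internal_nodes_def)
qed

lemma leave_leaf:
  assumes "i \<le> length x" "i = length x \<or> z \<noteq> x ! i"
  shows "take i x @ [z] \<in> leaves (kohlenbach_tree A F)"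
  using snoc_in_tree[OF assms(1)] leave_not_in_tree[OF assms] by (simp add: leaves_def)

text \<open>An infinite path leaves \<open>x\<close> at some index \<open>i \<le> length x\<close>,
  and its prefix of length \<open>i + 2\<close> is then outside the tree.\<close>

lemma wf_kohlenbach_tree: "wf_tree (kohlenbach_tree A F)"
  unfolding wf_tree_def
proof
  assume "\<exists>f. \<forall>n. map f [0..<n] \<in> kohlenbach_tree A F"
  then obtain f where f: "\<And>n. map f [0..<n] \<in> kohlenbach_tree A F" by blast
  obtain i where i: "i \<le> length x" "\<forall>j<i. f j = x ! j" "i = length x \<or> f i \<noteq> x ! i"
    by (rule exit_value_index)
  have "map f [0..<i] = take i x"
    using i(1,2) by (auto intro: nth_equalityI)
  then have "map f [0..<Suc (Suc i)] = take i x @ [f i, f (Suc i)]" by simp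
  then show False using f[of "Suc (Suc i)"] leave_not_in_tree[OF i(1,3)] by simp
qed

text \<open>Induction from the end of \<open>x\<close> towards the root. At the end all children are
  leaves; before it the child on the path already has the value \<open>w\<close>. Either way
  \<open>G\<close> is given a function with a hit and returns \<open>w\<close>.\<close>

lemma bar_recursor_value:
  assumes rec: "simplified_kohlenbach_bar_recursor A \<Phi>"
    and F_car: "F \<in> car A ((Nty \<^bold>\<rightarrow> Nty) \<^bold>\<rightarrow> Nty)" and G_car: "G \<in> car A ((Nty \<^bold>\<rightarrow> Nty) \<^bold>\<rightarrow> Nty)"
    and G: "\<And>h g. represents A h g \<Longrightarrow> ap A (Nty \<^bold>\<rightarrow> Nty) Nty G h = num A (answer False x w g)"
    and i: "i \<le> length x"
  shows "\<Phi> F G (num A (list_encode (take i x))) = Some w"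
proof -
  have node_value: "\<Phi> F G (num A (list_encode (take i x))) = Some w"
    if i: "i \<le> length x"
      and succ: "i < length x \<Longrightarrow> \<Phi> F G (num A (list_encode (take (Suc i) x))) = Some w" for i
  proof -
    have F2: "F \<in> car A (pure_ty 2)" and G2: "G \<in> car A (pure_ty 2)"
      using F_car G_car by (simp_all add: numeral_2_eq_2)
    note node = rec[unfolded simplified_kohlenbach_bar_recursor_def, rule_format,
        OF F2 G2 wf_kohlenbach_tree]
    have "take i x \<in> kohlenbach_tree A F"
      using take_internal[OF i] by (simp add: internal_nodes_def)
    then obtain g h m where g: "\<And>z. \<Phi> F G (num A (list_encode (take i x @ [z]))) = Some (g z)"
      and h: "represents A h g" "ap A (pure_ty 1) Nty G h = num A m"
      and m: "\<Phi> F G (num A (list_encode (take i x))) = Some m"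
      using node take_internal[OF i] by blast
    have leaf: "g z = 2 * list_encode (take i x @ [z]) + 1" if "i = length x \<or> z \<noteq> x ! i" for z
      using node leave_leaf[OF i that] g[of z] by (auto simp: leaves_def)
    have "g (x ! i) = w" if "i < length x"
      using succ[OF that] g[of "x ! i"] by (simp add: take_Suc_conv_app_nth[OF that])
    moreover have "i < length x \<Longrightarrow> 0 \<noteq> x ! i"
      using x by (force simp: path_def dest: nth_mem)
    then have "g 0 = 2 * list_encode (take i x @ [0]) + 1"
      using leaf[of 0] i by force
    ultimately have "hit x w g i" by (simp add: hit_def)
    then have "answer False x w g = w" using i by (auto simp: answer_def)
    then show ?thesis using G[OF h(1)] h(2) m by (simp add: num_inj)
  qed
  from assms(5) show ?thesis
  proof (induction rule: inc_induct)
    case base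
    show ?case by (rule node_value) auto
  next
    case (step i)
    then show ?case using node_value[of i] by simp
  qed
qed

end

end

section \<open>Refutation of a term computing a bar recursor\<close>

theorem theorem36:
  fixes A :: "'a type_structure"
    and \<Phi> :: "'a \<Rightarrow> 'a \<Rightarrow> 'a \<Rightarrow> nat option"
  assumes "extensional_tca A"
    and "T0_model A"
    and "simplified_kohlenbach_bar_recursor A \<Phi>"
  shows "\<not> T_min_computable A [pure_ty 2, pure_ty 2, pure_ty 0]
           (\<lambda>as. \<Phi> (as ! 0) (as ! 1) (as ! 2))"
proof
  assume "T_min_computable A [pure_ty 2, pure_ty 2, pure_ty 0]
           (\<lambda>as. \<Phi> (as ! 0) (as ! 1) (as ! 2))"
  then obtain M where M: "long_nf [pure_ty 2, pure_ty 2, pure_ty 0] M Nty"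
    and interp: "\<And>as m. valuation A [pure_ty 2, pure_ty 2, pure_ty 0] as \<Longrightarrow>
      interp A [pure_ty 2, pure_ty 2, pure_ty 0] as M (num A m) \<longleftrightarrow>
      \<Phi> (as ! 0) (as ! 1) (as ! 2) = Some m"
    unfolding T_min_computable_def by blast
  interpret T0_model A by fact
  let ?v = "VClo M [VOracle True, VOracle False, VNum 0]"
  have runs: "runs x w ?v w" if x: "path x" for x w
  proof -
    have "\<forall>b. \<exists>a\<in>car A ((Nty \<^bold>\<rightarrow> Nty) \<^bold>\<rightarrow> Nty).
        \<forall>h g. represents A h g \<longrightarrow> ap A (Nty \<^bold>\<rightarrow> Nty) Nty a h = num A (answer b x w g)"
      using functional_answer unfolding functional_def by blast
    then obtain orc where car: "\<And>b. orc b \<in> car A ((Nty \<^bold>\<rightarrow> Nty) \<^bold>\<rightarrow> Nty)"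
      and orc: "\<And>b h g. represents A h g \<Longrightarrow> ap A (Nty \<^bold>\<rightarrow> Nty) Nty (orc b) h = num A (answer b x w g)"
      by metis
    interpret oracle_model A x w 0 orc
      by unfold_locales (rule orc)
    \<comment> \<open>The third argument 0 is the code of the empty sequence, that is, of the root
      \<open>take 0 x\<close>.\<close>
    have "\<Phi> (orc True) (orc False) (num A 0) = Some w"
      using bar_recursor_value[OF x _ assms(3) car car orc, where i = 0] orc[of _ _ True]
      by (simp add: answer_def)
    moreover have "valuation A [pure_ty 2, pure_ty 2, pure_ty 0] (vals [])"
      using car num_in_car by (simp add: valuation_def vals_def numeral_2_eq_2)
    ultimately have "interp A (ctx []) (vals []) M (num A w)"
      using interp[of "vals []" w] by (simp add: vals_def ctx_def numeral_2_eq_2)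
    then have "sound [] M (num A w)" by (rule interp_sound) simp_all
    then show ?thesis
      using sound_num[of "[]" M w] M by (simp add: ctx_def env_def numeral_2_eq_2)
  qed
  let ?e = "[VOracle True, VOracle False, VNum 0]"
  have "env_rel [pure_ty 2, pure_ty 2, pure_ty 0] ?e ?e"
    by (simp add: env_rel_Cons env_rel_Nil numeral_2_eq_2 lrel_VOracle lrel_VNum)
  then have "lrel Nty ?v ?v"
    using fundamental M long_nf_pre_nf by blast
  then have "lwf ?v" by (rule lrel_NtyD)
  then show False
  proof (rule lwf_not_dense[of _ "[]"])
    show "path []" by (simp add: path_def)
    show "\<exists>m. runs y 0 ?v m" if "path y" for y
      using runs[OF that] by blast
    \<comment> \<open>At the start density is immediate: the term finds every \<open>w\<close> on
      every path, so \<open>s\<close> itself serves as \<open>y\<close>.\<close>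
    show "\<exists>y w. path y \<and> prefix s y \<and> B < w \<and> runs y w ?v w" if "path s" for s B
      using runs[OF that, of "Suc B"] that by (intro exI[of _ s] exI[of _ "Suc B"]) simp
  qed
qed

end
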